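(* Consider the singular perturbation problem $\mathbf{x}'=\mathbf{f}(\mathbf{x},\mathbf{z})$, $\mathbf{z}'=\varepsilon^{-1}\mathbf{g}(\mathbf{x},\mathbf{z})$ with a smooth solution $(\mathbf{x}(t),\mathbf{z}(t))$ as described in the context, and assume that the logarithmic norm bound $\mu(\mathbf{g}_{\mathbf{z}}(\mathbf{x},\mathbf{z}))\le-1$ holds. Consider an IMEX general linear method in component-partitioned form (see context) whose matrix $\mathbf{A}^I$ has eigenvalues with positive real part. Assume that the external stages at time $t_{n-1}$ are order one accurate: $$\xi^{[n-1]}=\mathbf{w}_0\otimes\mathbf{x}(t_{n-1})+\mathcal{O}(h),\qquad \zeta^{[n-1]}=\mathbf{w}_0\otimes\mathbf{z}(t_{n-1})+\mathcal{O}(h).$$ Then the nonlinear system of internal stage equations $$X^{[n]}=h(\mathbf{A}^E\otimes\mathbf{I}_m)\mathbf{f}(X^{[n]},Z^{[n]})+(\mathbf{U}^E\otimes\mathbf{I}_m)\xi^{[n-1]},$$ $$Z^{[n]}=h(\mathbf{A}^I\otimes\mathbf{I}_m)\varepsilon^{-1}\mathbf{g}(X^{[n]},Z^{[n]})+(\mathbf{U}^I\otimes\mathbf{I}_m)\zeta^{[n-1]}$$ has a unique solution for any $h\le h_0$, with $h_0$ sufficiently small but independent of $\varepsilon$. The solution satisfies $$X^{[n]}=\mathbf{1}_s\otimes\mathbf{x}(t_{n-1})+\mathcal{O}(h),\qquad Z^{[n]}=\mathbf{1}_s\otimes\mathbf{z}(t_{n-1})+\mathcal{O}(h).$$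
   Context: **Problem.** $\mathbf{x}(t),\mathbf{z}(t)\in\mathbb{R}^m$, $0<\varepsilon\ll1$, $\mathbf{f},\mathbf{g}$ smooth; $\mathbf{g}_{\mathbf{z}}$ is invertible. The logarithmic norm is $\mu(\mathbf{G})=\lim_{h\to0+}(\|\mathbf{I}+h\mathbf{G}\|-1)/h=\sup_{\mathbf{y}\ne0}\mathrm{Re}\langle\mathbf{G}\mathbf{y},\mathbf{y}\rangle/\langle\mathbf{y},\mathbf{y}\rangle$, and the bound $\mu(\mathbf{g}_{\mathbf{z}})\le-1$ is understood in an $\varepsilon$-independent neighborhood of the solution. The initial conditions lie on the smooth solution (after the initial transient), so that $\mathbf{x}(t)=\sum_{k\ge0}\mathbf{x}^k(t)\varepsilon^k$, $\mathbf{z}(t)=\sum_{k\ge0}\mathbf{z}^k(t)\varepsilon^k$ with smooth $\varepsilon$-independent coefficient functions. **Method.** Explicit component with coefficients $\mathbf{A}^E\in\mathbb{R}^{s\times s}$ (strictly lower triangular), $\mathbf{U}^E\in\mathbb{R}^{s\times r}$, $\mathbf{B}^E\in\mathbb{R}^{r\times s}$, $\mathbf{V}^E\in\mathbb{R}^{r\times r}$, and implicit component with coefficients $\mathbf{A}^I,\mathbf{U}^I,\mathbf{B}^I,\mathbf{V}^I$ of the same sizes, sharing the abscissae $\mathbf{c}\in\mathbb{R}^s$. The external stages $\xi^{[n-1]},\zeta^{[n-1]}\in\mathbb{R}^{mr}$ (for $\mathbf{x}$ and $\mathbf{z}$) are carried from step to step; $X^{[n]},Z^{[n]}\in\mathbb{R}^{ms}$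 are the internal stages; $\mathbf{f},\mathbf{g}$ are applied stage by stage; $h$ is the step size and $t_n=t_0+nh$. Both component methods are preconsistent: there is a vector $\mathbf{w}_0\in\mathbb{R}^r$ with $\mathbf{U}^E\mathbf{w}_0=\mathbf{U}^I\mathbf{w}_0=\mathbf{1}_s$ (the all-ones vector) and $\mathbf{V}^E\mathbf{w}_0=\mathbf{V}^I\mathbf{w}_0=\mathbf{w}_0$.
   Formalization: Uniqueness is claimed only among stages within a fixed radius, independent of ε, h and n, of the stacked solution values; global uniqueness fails when g has another zero far from the solution, as the logarithmic norm bound holds only near it. *)

theory Defs
  imports "HOL-Analysis.Analysis"
begin

(* Continuous differentiability of order k, by iterated directional derivatives.
   Derivatives are taken within S, so S should be a set on which Frechet derivatives are
   unique, such as an open set or a nondegenerate interval. *)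
primrec times_differentiable_on ::
  "nat \<Rightarrow> ('a::euclidean_space) set \<Rightarrow> ('a \<Rightarrow> 'b::real_normed_vector) \<Rightarrow> bool" where
  "times_differentiable_on 0 S f \<longleftrightarrow> continuous_on S f"
| "times_differentiable_on (Suc k) S f \<longleftrightarrow> f differentiable_on S \<and>
     (\<forall>v. times_differentiable_on k S (\<lambda>p. frechet_derivative f (at p within S) v))"

definition smooth_on :: "('a::euclidean_space) set \<Rightarrow> ('a \<Rightarrow> 'b::real_normed_vector) \<Rightarrow> bool" where
  "smooth_on S f \<longleftrightarrow> (\<forall>k. times_differentiable_on k S f)"

(* Logarithmic norm for the Euclidean operator norm. The limit exists for every G, since the
   quotient is nondecreasing in h and bounded below by minus the norm of G. *)
definition log_norm :: "real^'m^'m \<Rightarrow> real" where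
  "log_norm G =
     Lim (at_right 0) (\<lambda>h. (onorm (\<lambda>y. (mat 1 + h *\<^sub>R G) *v y) - 1) / h)"

definition jacobian_snd ::
  "((real^'m) \<times> (real^'m) \<Rightarrow> real^'m) \<Rightarrow> (real^'m) \<times> (real^'m) \<Rightarrow> real^'m^'m" where
  "jacobian_snd g p = jacobian (\<lambda>z. g (fst p, z)) (at (snd p))"

definition complex_eigenvalue :: "real^'n^'n \<Rightarrow> complex \<Rightarrow> bool" where
  "complex_eigenvalue A l \<longleftrightarrow>
     (\<exists>v::complex^'n. v \<noteq> 0 \<and> map_matrix complex_of_real A *v v = l *s v)"

(* The asymptotic series of y in powers of e, uniformly on T: every truncation has a remainder
   of the order of the first omitted power. Convergence of the series is not required. *)
definition smooth_eps_expansion ::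
  "real \<Rightarrow> real set \<Rightarrow> (real \<Rightarrow> real \<Rightarrow> real^'m) \<Rightarrow> (nat \<Rightarrow> real \<Rightarrow> real^'m) \<Rightarrow> bool" where
  "smooth_eps_expansion e_max T y yk \<longleftrightarrow>
     (\<forall>k. smooth_on T (yk k)) \<and>
     (\<forall>N. \<exists>C. \<forall>e\<in>{0<..e_max}. \<forall>t\<in>T.
        norm (y e t - (\<Sum>k\<le>N. e ^ k *\<^sub>R yk k t)) \<le> C * e ^ Suc N)"

(* Stacked vectors in R^(ms) and R^(mr) are block vectors: component i is the i-th block, an
   element of R^m. The norm of the block type is the Euclidean norm of the stacked vector. *)

definition kron_vec :: "real^'s \<Rightarrow> real^'m \<Rightarrow> real^'m^'s" where
  "kron_vec w x = (\<chi> i. (w $ i) *\<^sub>R x)"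

(* Action of the Kronecker product of A with the m-by-m identity on a stacked vector. *)
definition kron_id_mult :: "real^'r^'s \<Rightarrow> real^'m^'r \<Rightarrow> real^'m^'s" where
  "kron_id_mult A X = (\<chi> i. \<Sum>j\<in>UNIV. (A $ i $ j) *\<^sub>R (X $ j))"

definition stagewise ::
  "((real^'m) \<times> (real^'m) \<Rightarrow> real^'m) \<Rightarrow> real^'m^'s \<Rightarrow> real^'m^'s \<Rightarrow> real^'m^'s" where
  "stagewise f X Z = (\<chi> i. f (X $ i, Z $ i))"

record ('s::finite, 'r::finite) imex_glm =
  A_exp :: "real^'s^'s"
  U_exp :: "real^'r^'s"
  B_exp :: "real^'s^'r"
  V_exp :: "real^'r^'r"
  A_imp :: "real^'s^'s"
  U_imp :: "real^'r^'s"
  B_imp :: "real^'s^'r"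
  V_imp :: "real^'r^'r"
  abscissae :: "real^'s"

definition strictly_lower_triangular ::
  "real^('s::{finite,linorder})^('s::{finite,linorder}) \<Rightarrow> bool" where
  "strictly_lower_triangular A \<longleftrightarrow> (\<forall>i j. i \<le> j \<longrightarrow> A $ i $ j = 0)"

definition preconsistent :: "('s::finite, 'r::finite) imex_glm \<Rightarrow> real^'r \<Rightarrow> bool" where
  "preconsistent M w \<longleftrightarrow>
     U_exp M *v w = 1 \<and> U_imp M *v w = 1 \<and> V_exp M *v w = w \<and> V_imp M *v w = w"

definition stage_equations ::
  "('s::finite, 'r::finite) imex_glm \<Rightarrow>
   ((real^'m) \<times> (real^'m) \<Rightarrow> real^'m) \<Rightarrow> ((real^'m) \<times> (real^'m) \<Rightarrow> real^'m) \<Rightarrow>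
   real \<Rightarrow> real \<Rightarrow> real^'m^'r \<Rightarrow> real^'m^'r \<Rightarrow> real^'m^'s \<Rightarrow> real^'m^'s \<Rightarrow> bool" where
  "stage_equations M f g e h \<xi> \<zeta> X Z \<longleftrightarrow>
     X = h *\<^sub>R kron_id_mult (A_exp M) (stagewise f X Z) + kron_id_mult (U_exp M) \<xi> \<and>
     Z = h *\<^sub>R kron_id_mult (A_imp M) ((1 / e) *\<^sub>R stagewise g X Z) + kron_id_mult (U_imp M) \<zeta>"

end

theory Submission
  imports Defs "HOL-Computational_Algebra.Fundamental_Theorem_Algebra"
begin

text \<open>Put \<open>\<eta> = h / e\<close>, let \<open>J\<close> be the derivative of \<open>g\<close> in \<open>z\<close> at the solution value
  \<open>(x, z)\<close>, and let \<open>A\<close> be the implicit coefficient matrix. The equation for \<open>Z\<close> is stiff: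
  \<open>\<eta>\<close> is unbounded as \<open>e\<close> tends to \<open>0\<close>. It is therefore preconditioned with the linear
  operator \<open>P Z = Z - \<eta> A Z J\<^sup>T\<close>, where a stacked vector is read as a matrix whose rows are its
  blocks, so that \<open>A Z J\<^sup>T\<close> is the Kronecker product of \<open>A\<close> and \<open>J\<close> applied to \<open>Z\<close>.

  The core is the estimate \<open>\<kappa> (1 + \<eta>) \<parallel>Y\<parallel> \<le> \<parallel>P Y\<parallel>\<close> with one \<open>\<kappa> > 0\<close> for all
  \<open>\<eta> \<ge> 0\<close> and all points of the solution (\<open>stage_operator_bounded_below\<close>). An eigenvalue of the
  Kronecker product is a product of an eigenvalue of \<open>A\<close>, in the open right half plane, and an
  eigenvalue of \<open>J\<close>, whose real part is at most \<open>-1\<close> by the logarithmic norm bound. Such a product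
  is never a nonnegative real (\<open>product_eigenvalue_not_nonneg\<close>), so with \<open>\<theta> = \<eta> / (1 + \<eta>)\<close> the
  operator \<open>(1 - \<theta>) I - \<theta> (A \<otimes> J)\<close> is injective for every \<open>\<theta>\<close> in the closed unit
  interval. The endpoint \<open>\<theta> = 1\<close> represents infinite stiffness; including it makes the parameter set
  compact, and compactness turns injectivity into a uniform bound.

  With \<open>Q = P\<^sup>-\<^sup>1\<close> the stage equations read \<open>X = h A\<^sub>E f(X, Z) + U\<^sub>E \<xi>\<close> and
  \<open>Z = Q (\<eta> A (g(X, Z) - Z J\<^sup>T) + U\<^sub>I \<zeta>)\<close>. The bound on \<open>Q\<close> absorbs the factor
  \<open>\<eta>\<close>. On a ball of small radius \<open>\<rho>\<close> the map \<open>g(X, Z) - Z J\<^sup>T\<close> has a small Lipschitz constant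
  in \<open>Z\<close> (\<open>frozen_jacobian_increment\<close>), and the first equation has a factor \<open>h\<close>, so the
  coupled system can be solved by contraction (\<open>coupled_contraction_fixed_point\<close>). The stacked solution
  value satisfies the equations up to \<open>O(h)\<close>: preconsistency handles the external stages, and
  \<open>\<eta> g(x, z) = O(h)\<close> because \<open>g(x, z) = O(e)\<close> along the solution
  (\<open>trajectory_bounds\<close>). Hence the fixed point exists and lies within \<open>O(h)\<close> of it.\<close>

section \<open>The logarithmic norm and dissipativity\<close>

text \<open>By the Cauchy-Schwarz inequality every difference quotient of the operator norm at \<open>I\<close> in the
  direction \<open>G\<close> already dominates the Rayleigh quotient of \<open>G\<close>, so the limit does too.
  Since the logarithmic norm is defined by \<open>Lim\<close>, convergence of the quotients has to be shown as well: they are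
  nondecreasing in \<open>h\<close> by convexity of the norm, and bounded below by \<open>- \<parallel>G\<parallel>\<close>.\<close>

lemma log_norm_inner_le:
  fixes G :: "real^'m^'m"
  shows "(G *v y) \<bullet> y \<le> log_norm G * (norm y)\<^sup>2"
proof -
  define N where "N h = onorm (\<lambda>y. (mat 1 + h *\<^sub>R G) *v y)" for h
  define q where "q h = (N h - 1) / h" for h
  define c where "c = onorm ((*v) G)"
  have act: "(mat 1 + h *\<^sub>R G) *v y = y + h *\<^sub>R (G *v y)" for h y
    by (simp add: matrix_vector_mult_add_rdistrib scaleR_matrix_vector_assoc)
  have blG: "bounded_linear ((*v) G)" by simp
  have N_ge: "norm (y + h *\<^sub>R (G *v y)) \<le> N h * norm y" for h y
    using onorm[of "\<lambda>y. (mat 1 + h *\<^sub>R G) *v y" y] by (simp add: N_def act[symmetric])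
  have N_le: "N h \<le> b" if "\<And>y. norm (y + h *\<^sub>R (G *v y)) \<le> b * norm y" for h b
    unfolding N_def by (rule onorm_le) (simp add: act that)
  have inner_le_q: "(G *v y) \<bullet> y \<le> q h * (norm y)\<^sup>2" if "h > 0" for h y
  proof -
    have "(norm y)\<^sup>2 + h * ((G *v y) \<bullet> y) = (y + h *\<^sub>R (G *v y)) \<bullet> y"
      by (simp add: inner_add_left power2_norm_eq_inner)
    also have "\<dots> \<le> norm (y + h *\<^sub>R (G *v y)) * norm y" by (rule norm_cauchy_schwarz)
    also have "\<dots> \<le> (N h * norm y) * norm y" by (intro mult_right_mono N_ge) auto
    finally have "h * ((G *v y) \<bullet> y) \<le> (N h - 1) * (norm y)\<^sup>2"
      by (simp add: power2_eq_square algebra_simps)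
    then show ?thesis using that by (simp add: q_def field_simps)
  qed
  have q_mono: "q h \<le> q k" if "0 < h" "h \<le> k" for h k
  proof -
    have "N h \<le> (1 - h/k) + (h/k) * N k"
    proof (rule N_le)
      fix y
      have "y + h *\<^sub>R (G *v y) = (1 - h/k) *\<^sub>R y + (h/k) *\<^sub>R (y + k *\<^sub>R (G *v y))"
        using that by (simp add: algebra_simps)
      also have "norm \<dots> \<le> norm ((1 - h/k) *\<^sub>R y) + norm ((h/k) *\<^sub>R (y + k *\<^sub>R (G *v y)))"
        by (rule norm_triangle_ineq)
      also have "\<dots> \<le> (1 - h/k) * norm y + (h/k) * (N k * norm y)"
        using that mult_left_mono[OF N_ge, of "h/k" y k] by simp
      finally show "norm (y + h *\<^sub>R (G *v y)) \<le> ((1 - h/k) + (h/k) * N k) * norm y"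
        by (simp add: algebra_simps)
    qed
    then have "N h - 1 \<le> (h/k) * (N k - 1)" using that by (simp add: algebra_simps)
    then show ?thesis using that by (simp add: q_def pos_divide_le_eq mult.commute)
  qed
  have q_lower: "- c \<le> q h" if "h > 0" for h
  proof -
    obtain b :: "real^'m" where b: "norm b = 1" by (metis vector_choose_size zero_le_one)
    have "1 - h * c \<le> norm b - norm (h *\<^sub>R (G *v b))"
      using onorm[OF blG, of b] that b by (simp add: c_def)
    also have "\<dots> \<le> norm (b + h *\<^sub>R (G *v b))" using norm_diff_ineq by blast
    also have "\<dots> \<le> N h" using N_ge[of b h] b by simp
    finally show ?thesis using that by (simp add: q_def field_simps)
  qed
  have lim: "(q \<longlongrightarrow> Inf (q ` {0<..})) (at_right 0)"
  proof (rule decreasing_tendsto)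
    have bdd: "bdd_below (q ` {0<..})" using q_lower by (intro bdd_belowI[of _ "-c"]) auto
    show "\<forall>\<^sub>F n in at_right 0. Inf (q ` {0<..}) \<le> q n"
      using bdd by (auto intro!: always_eventually cINF_lower simp: eventually_at_filter)
    fix a assume "Inf (q ` {0<..}) < a"
    then obtain k where k: "k > 0" "q k < a"
      using bdd cInf_less_iff[of "q ` {0<..}" a] by auto
    show "\<forall>\<^sub>F n in at_right 0. q n < a"
      unfolding eventually_at_right_field using k
      by (intro exI[of _ k] conjI allI impI le_less_trans[OF q_mono[of _ k] k(2)]) auto
  qed
  have "log_norm G = Lim (at_right 0) q"
    unfolding log_norm_def q_def N_def ..
  also have "\<dots> = Inf (q ` {0<..})" using lim by (intro tendsto_Lim) auto
  finally have lim': "(q \<longlongrightarrow> log_norm G) (at_right 0)" using lim by simp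
  show ?thesis
  proof (rule tendsto_lowerbound[of "\<lambda>h. q h * (norm y)\<^sup>2"])
    show "((\<lambda>h. q h * (norm y)\<^sup>2) \<longlongrightarrow> log_norm G * (norm y)\<^sup>2) (at_right 0)"
      by (intro tendsto_intros lim')
    show "\<forall>\<^sub>F h in at_right 0. (G *v y) \<bullet> y \<le> q h * (norm y)\<^sup>2"
      using inner_le_q by (auto simp: eventually_at_filter)
  qed auto
qed

section \<open>Eigenvectors in invariant sets of matrices\<close>

text \<open>Multiplication by \<open>mat c\<close> from the left plays the part of scalar multiplication of matrices.\<close>

lemma mat_mult_nth: "(mat c ** B) $ i $ j = c * B $ i $ j"
  for c :: "'a::comm_semiring_1" and B :: "'a^'m^'s"
  by (simp add: matrix_matrix_mult_def mat_def mult_delta_left)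

lemma mat_commutes: "A ** (mat c ** Y) = mat c ** (A ** Y)"
  for A :: "'a::comm_semiring_1^'s^'s" and Y :: "'a^'m^'s"
  unfolding vec_eq_iff mat_mult_nth
  by (simp add: matrix_matrix_mult_def[of A] mat_mult_nth sum_distrib_left mult_ac)

lemma matrix_diff_ldistrib: "A ** (B - C) = A ** B - A ** C"
  for A :: "'a::ring_1^'n^'k" and B C :: "'a^'m^'n"
  by (simp add: matrix_matrix_mult_def vec_eq_iff right_diff_distrib sum_subtractf)

text \<open>Peels a linear factor off a polynomial in \<open>A\<close>. Since \<open>A - l\<close> commutes with the powers of \<open>A\<close>, it can be
  applied to \<open>Y\<close> first; multiplying \<open>q\<close> by the variable only shifts the summation index.\<close>

lemma sum_linear_factor:
  fixes A :: "complex^'s^'s" and Y :: "complex^'m^'s"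
  assumes "degree q < N"
  shows "(\<Sum>i<Suc N. mat (coeff ([:-l, 1:] * q) i) ** (((**) A) ^^ i) Y)
       = (\<Sum>i<N. mat (coeff q i) ** (((**) A) ^^ i) (A ** Y - mat l ** Y))"
proof -
  define sc where "sc c Y = (mat c :: complex^'s^'s) ** Y" for c and Y :: "complex^'m^'s"
  have sc_nth: "sc c Y $ i $ j = c * Y $ i $ j" for c Y i j
    by (simp add: sc_def mat_mult_nth)
  have sc_simps: "sc (c + d) Y = sc c Y + sc d Y" "sc (c * d) Y = sc c (sc d Y)"
    "sc (- c) Y = - sc c Y" "sc 0 Y = 0"
    "sc c (Y - Z) = sc c Y - sc c Z" for c d Y Z
    by (simp_all add: vec_eq_iff sc_nth algebra_simps)
  have pow_diff: "(((**) A) ^^ i) (Y - Z) = (((**) A) ^^ i) Y - (((**) A) ^^ i) Z"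
    for i and Y Z :: "complex^'m^'s"
    by (induction i) (auto simp: matrix_diff_ldistrib)
  have pow_sc: "(((**) A) ^^ i) (sc c Y) = sc c ((((**) A) ^^ i) Y)" for i c Y
    by (induction i) (auto simp: sc_def mat_commutes)
  have q0: "coeff q N = 0" using assms by (simp add: coeff_eq_0)
  have "(\<Sum>i<Suc N. sc (coeff ([:-l, 1:] * q) i) ((((**) A) ^^ i) Y))
      = (\<Sum>i<Suc N. sc (coeff (pCons 0 q) i) ((((**) A) ^^ i) Y))
        - (\<Sum>i<Suc N. sc (coeff q i) (sc l ((((**) A) ^^ i) Y)))"
    unfolding sum_subtractf[symmetric]
    by (intro sum.cong refl) (simp add: sc_simps mult.commute flip: sc_simps(2), simp add: vec_eq_iff sc_nth algebra_simps)
  also have "(\<Sum>i<Suc N. sc (coeff (pCons 0 q) i) ((((**) A) ^^ i) Y))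
      = (\<Sum>i<N. sc (coeff q i) ((((**) A) ^^ i) (A ** Y)))"
    unfolding sum.lessThan_Suc_shift by (simp add: sc_simps funpow_swap1 del: sum.lessThan_Suc)
  also have "(\<Sum>i<Suc N. sc (coeff q i) (sc l ((((**) A) ^^ i) Y)))
      = (\<Sum>i<N. sc (coeff q i) ((((**) A) ^^ i) (sc l Y)))"
    by (simp add: q0 sc_simps pow_sc)
  finally show ?thesis
    unfolding sum_subtractf[symmetric] sc_simps(5)[symmetric] pow_diff[symmetric]
    unfolding sc_def .
qed

text \<open>Split the annihilating polynomial into linear factors and apply them to \<open>Y\<close> one at a time. The vector
  remains in \<open>S\<close> throughout; the last nonzero vector before the result vanishes is the eigenvector.
  The degree bound \<open>N\<close> is left free so that the same sum can be used for all polynomials of the induction.\<close>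

lemma eigenvector_in_invariant_set:
  fixes A :: "complex^'s^'s" and Y :: "complex^'m^'s" and p :: "complex poly"
  assumes "p \<noteq> 0" "degree p < N" "(\<Sum>i<N. mat (coeff p i) ** (((**) A) ^^ i) Y) = 0"
    and "Y \<noteq> 0" "Y \<in> S" and inv: "\<And>Y l. Y \<in> S \<Longrightarrow> A ** Y - mat l ** Y \<in> S"
  shows "\<exists>l U. U \<noteq> 0 \<and> U \<in> S \<and> A ** U = mat l ** U"
  using assms(1-5)
proof (induction "degree p" arbitrary: p N Y)
  case 0
  then obtain c where c: "p = [:c:]" "c \<noteq> 0" by (metis degree_eq_zeroE pCons_0_0)
  obtain N' where N: "N = Suc N'" using 0 by (cases N) auto
  have "(\<Sum>i<N. mat (coeff p i) ** (((**) A) ^^ i) Y) = mat c ** Y"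
    unfolding N sum.lessThan_Suc_shift c by (simp del: sum.lessThan_Suc)
  then have "mat c ** Y = 0" using 0 by simp
  then have "c * Y $ i $ j = 0" for i j by (metis mat_mult_nth zero_index)
  then have "Y = 0" using c by (simp add: vec_eq_iff)
  then show ?case using 0 by simp
next
  case (Suc d)
  obtain l where "poly p l = 0"
    using fundamental_theorem_of_algebra[of p] Suc.hyps(2) by (auto simp: constant_degree)
  then obtain q where p: "p = [:-l, 1:] * q" by (metis poly_eq_0_iff_dvd dvdE)
  have q: "q \<noteq> 0" using p Suc.prems by auto
  then have deg: "degree p = Suc (degree q)" using p by (simp add: degree_mult_eq del: mult_pCons_left)
  obtain N' where N: "N = Suc N'" using Suc by (cases N) auto
  have sum0: "(\<Sum>i<N'. mat (coeff q i) ** (((**) A) ^^ i) (A ** Y - mat l ** Y)) = 0"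
    using sum_linear_factor[of q N' l A Y] Suc.prems(3) deg N Suc.prems(2) p by simp
  show ?case
  proof (cases "A ** Y - mat l ** Y = 0")
    case True
    then show ?thesis using Suc.prems by auto
  next
    case False
    then show ?thesis
      using Suc.hyps(1)[OF _ q _ sum0 False] inv[OF Suc.prems(5)] deg N Suc by auto
  qed
qed

lemma sequence_dependent:
  fixes B :: "nat \<Rightarrow> 'a::euclidean_space"
  shows "\<exists>c N. (\<exists>i<N. c i \<noteq> 0) \<and> (\<Sum>i<N. c i *\<^sub>R B i) = 0"
proof (cases "inj_on B {..DIM('a)}")
  case True
  then have "dependent (B ` {..DIM('a)})"
    by (intro dependent_biggerset) (auto simp: card_image)
  then obtain u k where u: "k \<le> DIM('a)" "u (B k) \<noteq> 0" "(\<Sum>v\<in>B ` {..DIM('a)}. u v *\<^sub>R v) = 0"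
    by (auto simp: dependent_finite)
  then have "(\<Sum>i<Suc (DIM('a)). u (B i) *\<^sub>R B i) = 0"
    using sum.reindex[OF True, of "\<lambda>v. u v *\<^sub>R v"] by (simp only: lessThan_Suc_atMost) simp
  then show ?thesis using u by (intro exI[of _ "\<lambda>i. u (B i)"] exI[of _ "Suc DIM('a)"])
      (auto simp del: sum.lessThan_Suc intro!: exI[of _ k])
next
  case False
  then obtain i j where ij: "i \<noteq> j" "B i = B j" by (auto simp: inj_on_def)
  define c where "c k = (if k = i then 1 else 0) - (if k = j then 1 else (0::real))" for k
  have "(\<Sum>k<Suc (i + j). c k *\<^sub>R B k) = 0"
    using ij by (simp add: c_def scaleR_diff_left sum_subtractf if_distrib[of "\<lambda>r. r *\<^sub>R _"] sum.delta' cong: if_cong del: sum.lessThan_Suc)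
  then show ?thesis using ij by (intro exI[of _ c] exI[of _ "Suc (i + j)"]) (auto simp: c_def intro!: exI[of _ i])
qed

lemma matrix_add_rdistrib: "(B + C) ** A = B ** A + C ** A"
  for A :: "'a::semiring_1^'m^'n" and B C :: "'a^'n^'s"
  by (simp add: matrix_matrix_mult_def vec_eq_iff distrib_right sum.distrib)

lemma map_matrix_of_real_mult:
  "map_matrix complex_of_real (A ** B) = map_matrix complex_of_real A ** map_matrix complex_of_real B"
  by (simp add: map_matrix_def matrix_matrix_mult_def vec_eq_iff)

text \<open>The kernel of the map taking \<open>Y\<close> to \<open>A Y J\<^sup>T - b Y\<close> over the complex numbers is
  invariant under multiplication by \<open>A\<close>, so if it
  is nontrivial it contains an eigenvector \<open>U\<close> of \<open>A\<close>, say for the eigenvalue \<open>l\<close>. A nonzero row of \<open>U\<close> is then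
  an eigenvector of \<open>J\<close> for \<open>b / l\<close>, whose real part is nonnegative because \<open>Re l > 0\<close>. This
  contradicts the dissipativity of \<open>J\<close>.\<close>

lemma product_eigenvalue_not_nonneg:
  fixes A :: "real^'s^'s" and J :: "real^'m^'m" and Y :: "real^'m^'s"
  assumes A: "\<And>l. complex_eigenvalue A l \<Longrightarrow> Re l > 0"
    and J: "\<And>y. (J *v y) \<bullet> y \<le> - (norm y)\<^sup>2"
    and "b \<ge> 0" and Y: "A ** Y ** transpose J = b *\<^sub>R Y"
  shows "Y = 0"
proof (rule ccontr)
  assume "Y \<noteq> 0"
  define Ac where "Ac = map_matrix complex_of_real A"
  define K where "K = map_matrix complex_of_real (transpose J)"
  define Yc where "Yc = map_matrix complex_of_real Y"
  define S where "S = {U :: complex^'m^'s. Ac ** U ** K = mat (of_real b) ** U}"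
  have "map_matrix complex_of_real (b *\<^sub>R Y) = mat (of_real b) ** Yc"
    unfolding vec_eq_iff mat_mult_nth by (simp add: Yc_def map_matrix_def)
  then have YcS: "Yc \<in> S"
    using arg_cong[OF Y, of "map_matrix complex_of_real"]
    by (simp add: S_def Ac_def K_def Yc_def map_matrix_of_real_mult)
  have Yc0: "Yc \<noteq> 0" using \<open>Y \<noteq> 0\<close> by (auto simp: Yc_def map_matrix_def vec_eq_iff)
  have inv: "Ac ** U - mat l ** U \<in> S" if "U \<in> S" for U l
  proof -
    have U: "Ac ** U ** K = mat (of_real b) ** U" using that by (simp add: S_def)
    have diff_mult: "(B - C) ** K = B ** K - C ** K" for B C :: "complex^'m^'s"
      by (simp add: matrix_matrix_mult_def vec_eq_iff left_diff_distrib sum_subtractf)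
    have "Ac ** (Ac ** U - mat l ** U) ** K = Ac ** (Ac ** U ** K) - mat l ** (Ac ** U ** K)"
      unfolding matrix_diff_ldistrib diff_mult mat_commutes[of Ac] by (simp add: matrix_mul_assoc)
    also have "\<dots> = mat (of_real b) ** (Ac ** U - mat l ** U)"
      unfolding U matrix_diff_ldistrib mat_commutes[of Ac] by (simp add: mat_commutes[of "mat l"])
    finally show ?thesis by (simp add: S_def)
  qed
  obtain c :: "nat \<Rightarrow> real" and N where c: "\<exists>i<N. c i \<noteq> 0" "(\<Sum>i<N. c i *\<^sub>R (((**) A) ^^ i) Y) = 0"
    using sequence_dependent[of "\<lambda>i. (((**) A) ^^ i) Y"] by auto
  define p where "p = (\<Sum>i<N. monom (complex_of_real (c i)) i)"
  have coeff_p: "coeff p i = (if i < N then of_real (c i) else 0)" for i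
    by (simp add: p_def coeff_sum)
  have "p \<noteq> 0" using c(1) coeff_p by (auto simp: poly_eq_iff)
  have "N > 0" using c(1) by auto
  then have "degree p < N"
    by (intro degree_lessI) (use \<open>N > 0\<close> in \<open>auto simp: coeff_p\<close>)
  have pow: "(((**) Ac) ^^ i) Yc = map_matrix complex_of_real ((((**) A) ^^ i) Y)" for i
    by (induction i) (auto simp: Yc_def Ac_def map_matrix_of_real_mult)
  have "(\<Sum>i<N. mat (coeff p i) ** (((**) Ac) ^^ i) Yc) = 0"
  proof -
    have "(\<Sum>i<N. mat (coeff p i) ** (((**) Ac) ^^ i) Yc) $ j $ k
        = of_real ((\<Sum>i<N. c i *\<^sub>R (((**) A) ^^ i) Y) $ j $ k)" for j k
      by (simp add: mat_mult_nth pow coeff_p map_matrix_def)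
    then show ?thesis unfolding c(2) by (simp add: vec_eq_iff)
  qed
  then obtain l U where U: "U \<noteq> 0" "U \<in> S" "Ac ** U = mat l ** U"
    using eigenvector_in_invariant_set[OF \<open>p \<noteq> 0\<close> \<open>degree p < N\<close> _ Yc0 YcS inv] by blast
  \<comment> \<open>A nonzero entry selects a column of \<open>U\<close>, an eigenvector of \<open>A\<close>, and a row of \<open>U\<close>, an eigenvector of \<open>J\<close>.\<close>
  then obtain i j where ij: "U $ i $ j \<noteq> 0" by (auto simp: vec_eq_iff)
  have "Ac *v column j U = l *s column j U"
    using U(3) by (simp add: vec_eq_iff mat_mult_nth column_def matrix_vector_mult_def)
      (simp add: matrix_matrix_mult_def)
  moreover have "column j U \<noteq> 0" using ij by (auto simp: vec_eq_iff column_def)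
  ultimately have l: "Re l > 0" using A unfolding complex_eigenvalue_def Ac_def by blast
  have "mat l ** (U ** K) = mat (of_real b) ** U"
    using U by (simp add: S_def matrix_mul_assoc)
  then have row: "l * (U ** K) $ i $ k = b * U $ i $ k" for k by (simp flip: mat_mult_nth)
  define \<gamma> where "\<gamma> = of_real b / l"
  have g: "Re \<gamma> \<ge> 0" using l \<open>b \<ge> 0\<close> by (simp add: \<gamma>_def Re_divide)
  define u v :: "real^'m" where "u = (\<chi> k. Re (U $ i $ k))" and "v = (\<chi> k. Im (U $ i $ k))"
  have UK: "(U ** K) $ i $ k = \<gamma> * U $ i $ k" for k
  proof -
    have "l \<noteq> 0" using l by auto
    then show ?thesis using row[of k] by (simp add: \<gamma>_def nonzero_eq_divide_eq mult.commute)
  qed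
  have Re_UK: "Re ((U ** K) $ i $ k) = (J *v u) $ k" and Im_UK: "Im ((U ** K) $ i $ k) = (J *v v) $ k" for k
    by (simp_all add: matrix_matrix_mult_def matrix_vector_mult_def K_def map_matrix_def transpose_def u_def v_def mult.commute)
  have Ju: "J *v u = Re \<gamma> *\<^sub>R u - Im \<gamma> *\<^sub>R v" and Jv: "J *v v = Im \<gamma> *\<^sub>R u + Re \<gamma> *\<^sub>R v"
    unfolding vec_eq_iff Re_UK[symmetric] Im_UK[symmetric] UK by (simp_all add: u_def v_def algebra_simps)
  have "(J *v u) \<bullet> u + (J *v v) \<bullet> v = Re \<gamma> * ((norm u)\<^sup>2 + (norm v)\<^sup>2)"
    unfolding Ju Jv by (simp add: power2_norm_eq_inner algebra_simps inner_commute)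
  then have "(norm u)\<^sup>2 + (norm v)\<^sup>2 \<le> 0"
    using J[of u] J[of v] mult_nonneg_nonneg[OF g, of "(norm u)\<^sup>2 + (norm v)\<^sup>2"] by simp
  then have "u = 0 \<and> v = 0" by (simp add: sum_power2_le_zero_iff)
  then have "Re (U $ i $ j) = 0 \<and> Im (U $ i $ j) = 0" by (simp add: u_def v_def vec_eq_iff)
  then show False using ij by (simp add: complex_eq_iff)
qed

section \<open>Uniform invertibility of the linearized implicit stage operator\<close>

text \<open>Dividing by \<open>1 + \<eta>\<close> replaces the unbounded parameter \<open>\<eta>\<close> by \<open>\<theta> = \<eta> / (1 + \<eta>)\<close> in the unit interval.
  The norm of \<open>(1 - \<theta>) Y - \<theta> A Y J\<^sup>T\<close> is continuous and positive on the compact set of all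
  \<open>\<theta>\<close>, all dissipative \<open>J\<close> of bounded norm and all unit vectors \<open>Y\<close>; its minimum is \<open>\<kappa>\<close>.\<close>

lemma stage_operator_bounded_below:
  fixes A :: "real^'s^'s"
  assumes A: "\<And>l. complex_eigenvalue A l \<Longrightarrow> Re l > 0"
  shows "\<exists>\<kappa>>0. \<forall>(J::real^'m^'m) \<eta> (Y::real^'m^'s).
     norm J \<le> B \<longrightarrow> (\<forall>y. (J *v y) \<bullet> y \<le> - (norm y)\<^sup>2) \<longrightarrow> 0 \<le> \<eta> \<longrightarrow>
     \<kappa> * (1 + \<eta>) * norm Y \<le> norm (Y - \<eta> *\<^sub>R (A ** (Y ** transpose J)))"
proof -
  define D where "D = {J :: real^'m^'m. norm J \<le> B \<and> (\<forall>y. (J *v y) \<bullet> y \<le> - (norm y)\<^sup>2)}"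
  define F where "F = (\<lambda>(\<theta>::real, J :: real^'m^'m, Y :: real^'m^'s).
     norm ((1 - \<theta>) *\<^sub>R Y - \<theta> *\<^sub>R (A ** (Y ** transpose J))))"
  define C where "C = {0..1::real} \<times> D \<times> sphere (0 :: real^'m^'s) 1"
  have "compact D"
  proof -
    have "closed {J :: real^'m^'m. (J *v y) \<bullet> y \<le> - (norm y)\<^sup>2}" for y
      by (intro closed_Collect_le continuous_intros) (simp_all add: matrix_vector_mult_def, intro continuous_intros)
    then have "closed (cball 0 B \<inter> (\<Inter>y. {J :: real^'m^'m. (J *v y) \<bullet> y \<le> - (norm y)\<^sup>2}))"
      by (intro closed_Int closed_INT) auto
    moreover have "D = cball 0 B \<inter> (\<Inter>y. {J. (J *v y) \<bullet> y \<le> - (norm y)\<^sup>2})" by (auto simp: D_def)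
    ultimately show ?thesis by (simp add: compact_eq_bounded_closed bounded_Int)
  qed
  then have compC: "compact C" unfolding C_def by (intro compact_Times) auto
  have contF: "continuous_on C F"
    unfolding F_def case_prod_unfold matrix_matrix_mult_def transpose_def
    by (intro continuous_intros)
  have pos: "F p > 0" if pC: "p \<in> C" for p
  proof -
    obtain \<theta> J Y where p: "p = (\<theta>, J, Y)" by (cases p)
    have t: "0 \<le> \<theta>" "\<theta> \<le> 1" and J: "\<And>y. (J *v y) \<bullet> y \<le> - (norm y)\<^sup>2" and Y: "Y \<noteq> 0"
      using pC by (auto simp: p C_def D_def)
    show ?thesis
    proof (rule ccontr)
      assume "\<not> F p > 0"
      then have eq: "(1 - \<theta>) *\<^sub>R Y = \<theta> *\<^sub>R (A ** (Y ** transpose J))" by (simp add: p F_def)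
      then have "\<theta> \<noteq> 0" using Y by auto
      then have "A ** Y ** transpose J = ((1 - \<theta>) / \<theta>) *\<^sub>R Y"
        using arg_cong[OF eq, of "\<lambda>V. (1/\<theta>) *\<^sub>R V"] by (simp add: matrix_mul_assoc)
      then show False using product_eigenvalue_not_nonneg[of A J "(1 - \<theta>) / \<theta>" Y] A J t Y by simp
    qed
  qed
  obtain \<kappa> where k: "\<kappa> > 0" "\<And>p. p \<in> C \<Longrightarrow> \<kappa> \<le> F p"
  proof (cases "C = {}")
    case True then show ?thesis using that[of 1] by auto
  next
    case False
    then show ?thesis using continuous_attains_inf[OF compC False contF] pos that by metis
  qed
  show ?thesis
  proof (intro exI[of _ \<kappa>] conjI allI impI k)
    fix J :: "real^'m^'m" and \<eta> :: real and Y :: "real^'m^'s"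
    assume J: "norm J \<le> B" "\<forall>y. (J *v y) \<bullet> y \<le> - (norm y)\<^sup>2" and eta: "0 \<le> \<eta>"
    let ?P = "Y - \<eta> *\<^sub>R (A ** (Y ** transpose J))"
    show "\<kappa> * (1 + \<eta>) * norm Y \<le> norm ?P"
    proof (cases "Y = 0")
      case True then show ?thesis by simp
    next
      case False
      define \<theta> where "\<theta> = \<eta> / (1 + \<eta>)"
      have th: "0 \<le> \<theta>" "\<theta> \<le> 1" "1 - \<theta> = 1 / (1 + \<eta>)" using eta by (auto simp: \<theta>_def field_simps)
      define n where "n = norm Y"
      have n: "n > 0" using False by (simp add: n_def)
      have "(\<theta>, J, (1/n) *\<^sub>R Y) \<in> C" using J th n by (simp add: C_def D_def n_def)
      then have "\<kappa> \<le> F (\<theta>, J, (1/n) *\<^sub>R Y)" by (rule k)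
      also have "\<dots> = norm ((1 / ((1 + \<eta>) * n)) *\<^sub>R ?P)"
        unfolding F_def prod.case th(3)
        by (simp add: matrix_scalar_ac \<theta>_def scaleR_right_diff_distrib flip: scalar_matrix_assoc)
      also have "\<dots> = norm ?P / ((1 + \<eta>) * n)" using eta n by simp
      finally show ?thesis using eta n by (simp add: pos_le_divide_eq n_def mult.assoc)
    qed
  qed
qed

lemma bounded_below_inverse:
  fixes P :: "'a::euclidean_space \<Rightarrow> 'a"
  assumes "linear P" "k > 0" and low: "\<And>Y. k * norm Y \<le> norm (P Y)"
  shows "\<exists>Q. (\<forall>Z W. P Z = W \<longleftrightarrow> Z = Q W) \<and> (\<forall>W W'. k * norm (Q W - Q W') \<le> norm (W - W'))"
proof -
  have "inj P"
  proof (rule linear_injective_0[THEN iffD2, OF \<open>linear P\<close>, rule_format])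
    show "Y = 0" if "P Y = 0" for Y using low[of Y] that \<open>k > 0\<close> by (simp add: mult_le_0_iff)
  qed
  then have "bij P" using \<open>linear P\<close> by (simp add: bij_def linear_injective_imp_surjective)
  then have PQ: "P (inv P W) = W" "inv P (P W) = W" for W by (simp_all add: bij_is_surj surj_f_inv_f bij_is_inj)
  have "k * norm (inv P W - inv P W') \<le> norm (W - W')" for W W'
    using low[of "inv P W - inv P W'"] linear_diff[OF \<open>linear P\<close>] by (simp add: PQ)
  then show ?thesis using PQ by (intro exI[of _ "inv P"]) auto
qed

section \<open>Quantitative consequences of continuous differentiability\<close>

lemma smooth_on_UNIV_C1:
  assumes "smooth_on UNIV g"
  shows "(g has_derivative frechet_derivative g (at p)) (at p)"
    and "continuous_on UNIV (\<lambda>p. frechet_derivative g (at p) v)"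
proof -
  have "times_differentiable_on (Suc 0) UNIV g" using assms unfolding smooth_on_def by blast
  then show "(g has_derivative frechet_derivative g (at p)) (at p)"
    and "continuous_on UNIV (\<lambda>p. frechet_derivative g (at p) v)"
    by (auto simp: differentiable_on_def frechet_derivative_works[symmetric])
qed

lemma norm_linear_le_sum_Basis:
  fixes A :: "'a::euclidean_space \<Rightarrow> 'b::real_normed_vector"
  assumes "linear A"
  shows "norm (A v) \<le> (\<Sum>b\<in>Basis. norm (A b)) * norm v"
proof -
  have "A v = A (\<Sum>b\<in>Basis. (v \<bullet> b) *\<^sub>R b)" by (simp add: euclidean_representation)
  also have "\<dots> = (\<Sum>b\<in>Basis. (v \<bullet> b) *\<^sub>R A b)"
    using assms by (simp add: linear_sum linear_cmul)
  also have "norm \<dots> \<le> (\<Sum>b\<in>Basis. norm (A b) * norm v)"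
    by (intro sum_norm_le) (simp add: mult.commute[of "norm (A _)"] mult_right_mono Basis_le_norm)
  finally show ?thesis by (simp add: sum_distrib_right)
qed

lemma C1_derivative_bounded:
  fixes g :: "'a::euclidean_space \<Rightarrow> 'b::real_normed_vector"
  assumes "smooth_on UNIV g"
  shows "\<exists>L\<ge>0. \<forall>p\<in>cball 0 R. \<forall>v. norm (frechet_derivative g (at p) v) \<le> L * norm v"
proof -
  let ?S = "\<lambda>p. \<Sum>b\<in>Basis. norm (frechet_derivative g (at p) b)"
  have "continuous_on (cball 0 R) ?S"
    by (intro continuous_intros continuous_on_subset[OF smooth_on_UNIV_C1(2)[OF assms]]) auto
  then have "bounded (?S ` cball 0 R)" by (intro compact_imp_bounded compact_continuous_image) auto
  then obtain L where L: "L > 0" "\<And>p. p \<in> cball 0 R \<Longrightarrow> ?S p \<le> L"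
    unfolding bounded_pos by (metis abs_le_D1 imageI real_norm_def)
  have "norm (frechet_derivative g (at p) v) \<le> L * norm v" if "p \<in> cball 0 R" for p v
    using norm_linear_le_sum_Basis[OF has_derivative_linear[OF smooth_on_UNIV_C1(1)[OF assms]], of p v]
      mult_right_mono[OF L(2)[OF that], of "norm v"] by simp
  then show ?thesis using L(1) by (intro exI[of _ L]) auto
qed

text \<open>Continuity of the directional derivatives along the finitely many basis vectors suffices for continuity of the
  derivative in the operator norm, which is uniform on the compact ball.\<close>

lemma C1_derivative_uniformly_continuous:
  fixes g :: "'a::euclidean_space \<Rightarrow> 'b::real_normed_vector"
  assumes "smooth_on UNIV g" "\<sigma> > 0"
  shows "\<exists>d>0. \<forall>p\<in>cball 0 R. \<forall>q\<in>cball 0 R. dist p q < d \<longrightarrow>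
     (\<forall>v. norm (frechet_derivative g (at p) v - frechet_derivative g (at q) v) \<le> \<sigma> * norm v)"
proof -
  let ?D = "\<lambda>p. frechet_derivative g (at p)"
  define s where "s = \<sigma> / DIM('a)"
  have s: "s > 0" using assms by (simp add: s_def)
  have "uniformly_continuous_on (cball 0 R) (\<lambda>p. ?D p b)" for b
    by (intro compact_uniformly_continuous continuous_on_subset[OF smooth_on_UNIV_C1(2)[OF assms(1)]]) auto
  then have "\<forall>b. \<exists>d>0. \<forall>p\<in>cball 0 R. \<forall>q\<in>cball 0 R. dist p q < d \<longrightarrow> norm (?D p b - ?D q b) < s"
    using s unfolding uniformly_continuous_on_def dist_norm by (metis norm_minus_commute)
  then obtain d where d: "\<And>b. d b > 0"
    "\<And>b p q. p \<in> cball 0 R \<Longrightarrow> q \<in> cball 0 R \<Longrightarrow> dist p q < d b \<Longrightarrow> norm (?D p b - ?D q b) < s"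
    by metis
  define m where "m = Min (d ` Basis)"
  have "m > 0" using d by (simp add: m_def)
  have "norm (?D p v - ?D q v) \<le> \<sigma> * norm v"
    if "p \<in> cball 0 R" "q \<in> cball 0 R" "dist p q < m" for p q v
  proof -
    have "norm (?D p b - ?D q b) \<le> s" if "b \<in> Basis" for b
      using d(2)[OF \<open>p \<in> _\<close> \<open>q \<in> _\<close>, of b] \<open>dist p q < m\<close> that by (auto simp: m_def intro: less_imp_le)
    then have "(\<Sum>b\<in>Basis. norm (?D p b - ?D q b)) \<le> \<sigma>"
      using sum_bounded_above[of "Basis :: 'a set" "\<lambda>b. norm (?D p b - ?D q b)" s] by (simp add: s_def)
    moreover have "linear (\<lambda>v. ?D p v - ?D q v)"
      by (rule linear_compose_sub[OF has_derivative_linear[OF smooth_on_UNIV_C1(1)[OF assms(1)]]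
            has_derivative_linear[OF smooth_on_UNIV_C1(1)[OF assms(1)]]])
    ultimately show ?thesis
      using norm_linear_le_sum_Basis[of "\<lambda>v. ?D p v - ?D q v" v]
      by (meson mult_right_mono norm_ge_zero order_trans)
  qed
  then show ?thesis using \<open>m > 0\<close> by blast
qed

lemma C1_lipschitz_on_ball:
  fixes g :: "'a::euclidean_space \<Rightarrow> 'b::real_normed_vector"
  assumes "smooth_on UNIV g"
  shows "\<exists>L\<ge>0. \<forall>p\<in>cball 0 R. \<forall>q\<in>cball 0 R. norm (g p - g q) \<le> L * norm (p - q)"
proof -
  obtain L where L: "L \<ge> 0" "\<And>p v. p \<in> cball 0 R \<Longrightarrow> norm (frechet_derivative g (at p) v) \<le> L * norm v"
    using C1_derivative_bounded[OF assms] by metis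
  have "onorm (frechet_derivative g (at p)) \<le> L" if "p \<in> cball 0 R" for p
    by (rule onorm_le) (rule L(2)[OF that])
  then have "norm (g p - g q) \<le> L * norm (p - q)" if "p \<in> cball 0 R" "q \<in> cball 0 R" for p q
    using that
    by (intro differentiable_bound[OF convex_cball, of 0 R g "\<lambda>p. frechet_derivative g (at p)"])
      (auto intro: has_derivative_at_withinI smooth_on_UNIV_C1(1)[OF assms])
  then show ?thesis using L(1) by blast
qed

lemma jacobian_snd_mult:
  assumes "smooth_on UNIV g"
  shows "jacobian_snd g p *v w = frechet_derivative g (at p) (0, w)"
proof -
  let ?D = "frechet_derivative g (at p)"
  have "(Pair (fst p) has_derivative Pair 0) (at (snd p))"
    by (auto intro!: derivative_eq_intros)
  then have "((\<lambda>z. g (fst p, z)) has_derivative (\<lambda>w. ?D (0, w))) (at (snd p))"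
    using has_derivative_compose[of "Pair (fst p)" "Pair 0" "snd p" UNIV g ?D] smooth_on_UNIV_C1(1)[OF assms, of p]
    by simp
  then have "frechet_derivative (\<lambda>z. g (fst p, z)) (at (snd p)) = (\<lambda>w. ?D (0, w))" "linear (\<lambda>w. ?D (0, w))"
    by (auto simp: frechet_derivative_at[symmetric] dest: has_derivative_linear)
  then show ?thesis by (simp add: jacobian_snd_def jacobian_def matrix_works)
qed

text \<open>Provides the norm bound that makes the set of partial Jacobians along the solution relatively compact.\<close>

lemma jacobian_snd_bounded:
  fixes g :: "(real^'m) \<times> (real^'m) \<Rightarrow> real^'m"
  assumes "smooth_on UNIV g"
  shows "\<exists>B. \<forall>p\<in>cball 0 R. norm (jacobian_snd g p) \<le> B"
proof -
  obtain L where L: "L \<ge> 0" "\<And>p v. p \<in> cball 0 R \<Longrightarrow> norm (frechet_derivative g (at p) v) \<le> L * norm v"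
    using C1_derivative_bounded[OF assms] by metis
  have "norm (jacobian_snd g p) \<le> (\<Sum>i\<in>(UNIV::'m set). \<Sum>j\<in>(UNIV::'m set). L)" if p: "p \<in> cball 0 R" for p
  proof -
    let ?J = "jacobian_snd g p"
    have "norm (?J $ i $ j) \<le> L" for i j
    proof -
      have "?J $ i $ j = (?J *v axis j 1) $ i"
        by (simp add: matrix_vector_mul_component inner_axis)
      then show ?thesis
        using L(2)[OF p, of "(0, axis j 1)"] component_le_norm_cart[of "?J *v axis j 1" i]
        by (simp add: jacobian_snd_mult[OF assms] norm_Pair)
    qed
    then have "norm (?J $ i) \<le> (\<Sum>j\<in>(UNIV::'m set). L)" for i
      by (intro order_trans[OF norm_le_l1_cart] sum_mono) auto
    then show ?thesis
      by (subst norm_vec_def, intro order_trans[OF L2_set_le_sum] sum_mono) auto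
  qed
  then show ?thesis by blast
qed

text \<open>Subtracting the Jacobian frozen at the centre removes the linear part of \<open>g\<close> in its second argument. What is left
  has an arbitrarily small Lipschitz constant there, at the price of a small radius; the radius is the same for all
  centres in the ball. In the first argument the Lipschitz constant is merely finite.\<close>

lemma frozen_jacobian_increment:
  fixes g :: "(real^'m) \<times> (real^'m) \<Rightarrow> real^'m"
  assumes g: "smooth_on UNIV g" and "\<sigma> > 0"
  shows "\<exists>L\<ge>0. \<exists>\<rho>>0. \<forall>x z. (x, z) \<in> cball 0 R \<longrightarrow>
     (\<forall>u\<in>cball x \<rho>. \<forall>v\<in>cball z \<rho>. \<forall>u'\<in>cball x \<rho>. \<forall>v'\<in>cball z \<rho>.
       norm (g (u, v) - g (u', v') - jacobian_snd g (x, z) *v (v - v')) \<le> L * norm (u - u') + \<sigma> * norm (v - v'))"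
proof -
  let ?D = "\<lambda>p. frechet_derivative g (at p)"
  obtain L where L: "L \<ge> 0" "\<And>p v. p \<in> cball 0 (R + 1) \<Longrightarrow> norm (?D p v) \<le> L * norm v"
    using C1_derivative_bounded[OF g] by metis
  obtain d where d: "d > 0" "\<And>p q v. p \<in> cball 0 (R + 1) \<Longrightarrow> q \<in> cball 0 (R + 1) \<Longrightarrow> dist p q < d \<Longrightarrow>
     norm (?D p v - ?D q v) \<le> \<sigma> * norm v"
    using C1_derivative_uniformly_continuous[OF g \<open>\<sigma> > 0\<close>, of "R + 1"] by metis
  \<comment> \<open>A product of two balls of radius \<open>\<rho>\<close> lies in a ball of radius \<open>2 \<rho>\<close>, which has to stay below \<open>d\<close> and inside the enlarged ball of radius \<open>R + 1\<close>.\<close>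
  define \<rho> where "\<rho> = min 1 d / 4"
  have \<rho>: "\<rho> > 0" "2 * \<rho> < d" "2 * \<rho> \<le> 1" using d(1) by (auto simp: \<rho>_def)
  have "norm (g (u, v) - g (u', v') - jacobian_snd g (x, z) *v (v - v')) \<le> (\<sigma> + L) * norm (u - u') + \<sigma> * norm (v - v')"
    if c: "(x, z) \<in> cball 0 R" and "u \<in> cball x \<rho>" "v \<in> cball z \<rho>" "u' \<in> cball x \<rho>" "v' \<in> cball z \<rho>"
    for x z u v u' v'
  proof -
    let ?c = "(x, z)" let ?S = "cball x \<rho> \<times> cball z \<rho>"
    have S: "dist p ?c < d \<and> p \<in> cball 0 (R + 1)" if "p \<in> ?S" for p
    proof -
      have "dist p ?c \<le> dist (fst p) x + dist (snd p) z"
        by (cases p) (simp add: dist_Pair_Pair sqrt_sum_squares_le_sum)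
      also have "\<dots> \<le> 2 * \<rho>" using that by (auto simp: dist_commute)
      finally have "dist p ?c \<le> 2 * \<rho>" .
      moreover have "norm p \<le> norm ?c + dist p ?c" by (metis dist_norm norm_triangle_sub)
      ultimately show ?thesis using \<rho> c by auto
    qed
    have pq: "(u, v) \<in> ?S" "(u', v') \<in> ?S" using that by auto
    have cS: "?c \<in> ?S" using \<rho> by auto
    have "norm (g (u, v) - g (u', v') - ?D ?c ((u, v) - (u', v'))) \<le> norm ((u, v) - (u', v')) * \<sigma>"
    proof (rule differentiable_bound_linearization[where S = ?S and f' = ?D])
      show "(u', v') + t *\<^sub>R ((u, v) - (u', v')) \<in> ?S" if "t \<in> {0..1}" for t
        using convexD_alt[OF convex_Times[OF convex_cball convex_cball] pq(2,1), of t] that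
        by (simp add: algebra_simps)
      show "onorm (?D p - ?D ?c) \<le> \<sigma>" if "p \<in> ?S" for p
        using S[OF that] S[OF cS] by (intro onorm_le) (simp add: d(2))
    qed (auto intro: has_derivative_at_withinI smooth_on_UNIV_C1(1)[OF g] simp: cS \<rho>(1) less_imp_le)
    also have "\<dots> \<le> \<sigma> * (norm (u - u') + norm (v - v'))"
      using \<open>\<sigma> > 0\<close> norm_Pair_le[of "u - u'" "v - v'"] by (simp add: mult.commute)
    finally have 1: "norm (g (u, v) - g (u', v') - ?D ?c ((u, v) - (u', v'))) \<le> \<dots>" .
    have "?D ?c ((u, v) - (u', v')) = ?D ?c (u - u', 0) + jacobian_snd g ?c *v (v - v')"
      using linear_add[OF has_derivative_linear[OF smooth_on_UNIV_C1(1)[OF g]], of ?c "(u - u', 0)" "(0, v - v')"]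
      by (simp add: jacobian_snd_mult[OF g])
    then have "g (u, v) - g (u', v') - jacobian_snd g ?c *v (v - v')
       = (g (u, v) - g (u', v') - ?D ?c ((u, v) - (u', v'))) + ?D ?c (u - u', 0)" by simp
    also have "norm \<dots> \<le> \<sigma> * (norm (u - u') + norm (v - v')) + L * norm (u - u')"
      using L(2)[of ?c "(u - u', 0)"] S[OF cS] by (intro norm_triangle_mono[OF 1]) (simp add: norm_Pair)
    finally show ?thesis by (simp add: algebra_simps)
  qed
  moreover have "\<sigma> + L \<ge> 0" using L(1) \<open>\<sigma> > 0\<close> by simp
  ultimately show ?thesis using \<rho>(1) by blast
qed

section \<open>The solution stays near the slow manifold\<close>

text \<open>The leading term of the expansion lies on the slow manifold. Otherwise, for \<open>a = g(x0 t, z0 t) \<noteq> 0\<close>,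
  the component of \<open>g\<close> along \<open>a\<close> stays bounded away from \<open>0\<close> on a whole interval, for all small
  \<open>e\<close>. Then \<open>z e\<close> moves along \<open>a\<close> with speed of order \<open>1 / e\<close> on this interval, although it is bounded
  uniformly in \<open>e\<close>.\<close>

lemma reduced_problem_constraint:
  fixes g :: "(real^'m) \<times> (real^'m) \<Rightarrow> real^'m"
  assumes "t0 < T" "e_max > 0"
    and lip: "L \<ge> 0" "\<And>p q. p \<in> cball 0 R \<Longrightarrow> q \<in> cball 0 R \<Longrightarrow> norm (g p - g q) \<le> L * norm (p - q)"
    and ode: "\<And>e t. \<lbrakk>0 < e; e \<le> e_max; t \<in> {t0..T}\<rbrakk> \<Longrightarrow>
           (z e has_vector_derivative (1 / e) *\<^sub>R g (x e t, z e t)) (at t within {t0..T})"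
    and cont: "continuous_on {t0..T} x0" "continuous_on {t0..T} z0"
    and R0: "\<And>t. t \<in> {t0..T} \<Longrightarrow> (x0 t, z0 t) \<in> cball 0 R"
    and R: "\<And>e t. \<lbrakk>0 < e; e \<le> e_max; t \<in> {t0..T}\<rbrakk> \<Longrightarrow> (x e t, z e t) \<in> cball 0 R"
    and close: "\<And>e t. \<lbrakk>0 < e; e \<le> e_max; t \<in> {t0..T}\<rbrakk> \<Longrightarrow> norm ((x e t, z e t) - (x0 t, z0 t)) \<le> C * e"
    and t: "t \<in> {t0..T}"
  shows "g (x0 t, z0 t) = 0"
proof (rule ccontr)
  define a where "a = g (x0 t, z0 t)"
  assume "g (x0 t, z0 t) \<noteq> 0"
  then have a: "norm a > 0" by (simp add: a_def)
  have contg: "continuous_on (cball 0 R) g"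
    using lip by (intro lipschitz_on_continuous_on[of L]) (auto simp: lipschitz_on_def dist_norm)
  have "continuous_on {t0..T} (\<lambda>s. a \<bullet> g (x0 s, z0 s))"
    using R0 by (intro continuous_intros continuous_on_compose2[OF contg] cont) auto
  then obtain d where d: "d > 0" "\<And>s. s \<in> {t0..T} \<Longrightarrow> dist s t < d \<Longrightarrow>
      dist (a \<bullet> g (x0 s, z0 s)) (a \<bullet> a) < (norm a)\<^sup>2 / 2"
    using t a unfolding continuous_on_iff a_def by (metis half_gt_zero zero_less_power)
  obtain s1 s2 where s: "s1 < s2" "{s1..s2} \<subseteq> {t0..T}" "\<And>s. s \<in> {s1..s2} \<Longrightarrow> dist s t < d"
  proof (cases "t < T")
    case True
    then show ?thesis using that[of t "min T (t + d/2)"] t d(1) by (auto simp: dist_real_def)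
  next
    case False
    then show ?thesis using that[of "max t0 (t - d/2)" t] t d(1) \<open>t0 < T\<close> by (auto simp: dist_real_def)
  qed
  define H where "H = (s2 - s1) * (norm a)\<^sup>2 / 2"
  define Q where "Q = norm a * (2 * R) + (s2 - s1) * (norm a * (L * C))"
  have H: "H > 0" using s a by (simp add: H_def)
  \<comment> \<open>\<open>H\<close> is the guaranteed movement along \<open>a\<close> multiplied by \<open>e\<close>; \<open>Q\<close> collects the bound on \<open>z\<close> and the error from replacing the solution by its leading term.\<close>
  have key: "H \<le> Q * e" if e: "0 < e" "e \<le> e_max" for e
  proof -
    have "\<exists>s\<in>{s1<..<s2}. a \<bullet> z e s2 - a \<bullet> z e s1 = a \<bullet> ((s2 - s1) *\<^sub>R ((1 / e) *\<^sub>R g (x e s, z e s)))"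
    proof (rule mvt_simple[OF s(1), where f' = "\<lambda>s h. a \<bullet> (h *\<^sub>R ((1 / e) *\<^sub>R g (x e s, z e s)))"])
      fix s assume "s1 \<le> s" "s \<le> s2"
      then have "(z e has_derivative (\<lambda>h. h *\<^sub>R ((1 / e) *\<^sub>R g (x e s, z e s)))) (at s within {s1..s2})"
        using ode[OF e, of s] s(2) unfolding has_vector_derivative_def by (auto intro: has_derivative_subset)
      then show "((\<lambda>s. a \<bullet> z e s) has_derivative (\<lambda>h. a \<bullet> (h *\<^sub>R ((1 / e) *\<^sub>R g (x e s, z e s))))) (at s within {s1..s2})"
        by (rule has_derivative_inner_right)
    qed
    then obtain \<tau> where "\<tau> \<in> {s1<..<s2}"
      and "a \<bullet> z e s2 - a \<bullet> z e s1 = a \<bullet> ((s2 - s1) *\<^sub>R ((1 / e) *\<^sub>R g (x e \<tau>, z e \<tau>)))" by blast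
    then have tau: "\<tau> \<in> {s1..s2}"
      and mv: "a \<bullet> z e s2 - a \<bullet> z e s1 = (s2 - s1) / e * (a \<bullet> g (x e \<tau>, z e \<tau>))" by auto
    have tT: "\<tau> \<in> {t0..T}" using tau s by auto
    have "\<bar>a \<bullet> (g (x e \<tau>, z e \<tau>) - g (x0 \<tau>, z0 \<tau>))\<bar> \<le> norm a * norm (g (x e \<tau>, z e \<tau>) - g (x0 \<tau>, z0 \<tau>))"
      by (rule Cauchy_Schwarz_ineq2)
    also have "\<dots> \<le> norm a * (L * (C * e))"
      using order_trans[OF lip(2)[OF R[OF e tT] R0[OF tT]] mult_left_mono[OF close[OF e tT] lip(1)]]
      by (intro mult_left_mono) auto
    finally have 1: "a \<bullet> g (x0 \<tau>, z0 \<tau>) - norm a * (L * (C * e)) \<le> a \<bullet> g (x e \<tau>, z e \<tau>)"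
      by (simp add: inner_diff_right)
    have "(norm a)\<^sup>2 / 2 \<le> a \<bullet> g (x0 \<tau>, z0 \<tau>)"
      using d(2)[OF tT s(3)[OF tau]] unfolding dist_real_def power2_norm_eq_inner by linarith
    then have "(norm a)\<^sup>2 / 2 - norm a * (L * (C * e)) \<le> a \<bullet> g (x e \<tau>, z e \<tau>)" using 1 by simp
    then have "(s2 - s1) * ((norm a)\<^sup>2 / 2 - norm a * (L * (C * e))) \<le> (s2 - s1) * (a \<bullet> g (x e \<tau>, z e \<tau>))"
      using s by (intro mult_left_mono) auto
    also have "\<dots> = e * (a \<bullet> (z e s2 - z e s1))" using mv e by (simp add: inner_diff_right)
    also have "\<dots> \<le> e * (norm a * norm (z e s2 - z e s1))"
      using e norm_cauchy_schwarz[of a] by (intro mult_left_mono) auto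
    also have "\<dots> \<le> e * (norm a * (2 * R))"
    proof -
      have "norm (z e s') \<le> R" if "s' \<in> {t0..T}" for s'
        using R[OF e that] norm_snd_le[of "z e s'" "x e s'"] by simp
      moreover have "s1 \<in> {t0..T}" "s2 \<in> {t0..T}" using s by auto
      ultimately have "norm (z e s2 - z e s1) \<le> 2 * R"
        using norm_triangle_ineq4[of "z e s2" "z e s1"] by (smt (verit))
      then show ?thesis using e by (intro mult_left_mono) auto
    qed
    finally show ?thesis by (simp add: H_def Q_def algebra_simps)
  qed
  have "Q > 0" using key[of e_max] H \<open>e_max > 0\<close> by (smt (verit) zero_less_mult_iff)
  define e where "e = min e_max (H / (2 * Q))"
  have "0 < e" "e \<le> e_max" "Q * e \<le> H / 2"
    using H \<open>Q > 0\<close> \<open>e_max > 0\<close> mult_left_mono[of e "H / (2 * Q)" Q] by (auto simp: e_def)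
  then show False using key[of e] H by simp
qed

text \<open>Since \<open>g\<close> vanishes at the leading term and is Lipschitz, the distance \<open>O(e)\<close> of the solution to the leading
  term gives \<open>g = O(e)\<close> along the solution. A uniform bound on the derivative of \<open>z\<close> would give the same, but
  an expansion of the functions does not by itself bound derivatives.\<close>

lemma trajectory_bounds:
  fixes g :: "(real^'m) \<times> (real^'m) \<Rightarrow> real^'m"
  assumes g: "smooth_on UNIV g" and "t0 < T" "e_max > 0"
    and ode: "\<And>e t. \<lbrakk>0 < e; e \<le> e_max; t \<in> {t0..T}\<rbrakk> \<Longrightarrow>
           (z e has_vector_derivative (1 / e) *\<^sub>R g (x e t, z e t)) (at t within {t0..T})"
    and x: "smooth_eps_expansion e_max {t0..T} x xk"
    and z: "smooth_eps_expansion e_max {t0..T} z zk"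
  shows "\<exists>R G. \<forall>e t. 0 < e \<longrightarrow> e \<le> e_max \<longrightarrow> t \<in> {t0..T} \<longrightarrow>
     norm (x e t, z e t) \<le> R \<and> norm (g (x e t, z e t)) \<le> G * e"
proof -
  have leading: "continuous_on {t0..T} (yk 0) \<and> (\<exists>C. \<forall>e\<in>{0<..e_max}. \<forall>t\<in>{t0..T}. norm (y e t - yk 0 t) \<le> C * e)"
    if y: "smooth_eps_expansion e_max {t0..T} y yk" for y and yk :: "nat \<Rightarrow> real \<Rightarrow> real^'m"
  proof -
    have "smooth_on {t0..T} (yk 0)" using y by (simp add: smooth_eps_expansion_def)
    then have "times_differentiable_on 0 {t0..T} (yk 0)" unfolding smooth_on_def by blast
    moreover obtain C where "\<forall>e\<in>{0<..e_max}. \<forall>t\<in>{t0..T}. norm (y e t - (\<Sum>k\<le>0. e ^ k *\<^sub>R yk k t)) \<le> C * e ^ Suc 0"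
      using y unfolding smooth_eps_expansion_def by blast
    ultimately show ?thesis by auto
  qed
  define x0 z0 where "x0 = xk 0" and "z0 = zk 0"
  obtain Cx Cz where cont: "continuous_on {t0..T} x0" "continuous_on {t0..T} z0"
    and Cx: "\<And>e t. 0 < e \<Longrightarrow> e \<le> e_max \<Longrightarrow> t \<in> {t0..T} \<Longrightarrow> norm (x e t - x0 t) \<le> Cx * e"
    and Cz: "\<And>e t. 0 < e \<Longrightarrow> e \<le> e_max \<Longrightarrow> t \<in> {t0..T} \<Longrightarrow> norm (z e t - z0 t) \<le> Cz * e"
    using leading[OF x] leading[OF z] unfolding x0_def z0_def by (metis greaterThanAtMost_iff)
  define C where "C = \<bar>Cx\<bar> + \<bar>Cz\<bar>"
  have close: "norm ((x e t, z e t) - (x0 t, z0 t)) \<le> C * e" if e: "0 < e" "e \<le> e_max" "t \<in> {t0..T}" for e t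
  proof -
    have "norm ((x e t, z e t) - (x0 t, z0 t)) \<le> norm (x e t - x0 t) + norm (z e t - z0 t)"
      by (simp add: norm_Pair_le)
    also have "\<dots> \<le> Cx * e + Cz * e" by (intro add_mono Cx Cz e)
    also have "\<dots> \<le> \<bar>Cx\<bar> * e + \<bar>Cz\<bar> * e" using e by (intro add_mono mult_right_mono) auto
    finally show ?thesis by (simp add: C_def algebra_simps)
  qed
  have "bounded ((\<lambda>t. (x0 t, z0 t)) ` {t0..T})"
    by (intro compact_imp_bounded compact_continuous_image continuous_intros cont) auto
  then obtain R0 where R0: "\<And>t. t \<in> {t0..T} \<Longrightarrow> norm (x0 t, z0 t) \<le> R0" unfolding bounded_iff by blast
  define R where "R = R0 + C * e_max"
  have C: "C \<ge> 0" by (simp add: C_def)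
  have R0R: "(x0 t, z0 t) \<in> cball 0 R" if "t \<in> {t0..T}" for t
    using R0[OF that] C \<open>e_max > 0\<close> by (simp add: R_def add_increasing2)
  have R: "(x e t, z e t) \<in> cball 0 R" if e: "0 < e" "e \<le> e_max" "t \<in> {t0..T}" for e t
  proof -
    have "norm (x e t, z e t) \<le> norm (x0 t, z0 t) + norm ((x e t, z e t) - (x0 t, z0 t))"
      by (rule norm_triangle_sub)
    also have "\<dots> \<le> R0 + C * e_max"
      using C e by (intro add_mono R0 order_trans[OF close] mult_left_mono) auto
    finally show ?thesis by (simp add: R_def)
  qed
  obtain L where L: "L \<ge> 0" "\<And>p q. p \<in> cball 0 R \<Longrightarrow> q \<in> cball 0 R \<Longrightarrow> norm (g p - g q) \<le> L * norm (p - q)"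
    using C1_lipschitz_on_ball[OF g] by metis
  have "norm (g (x e t, z e t)) \<le> L * C * e" if e: "0 < e" "e \<le> e_max" "t \<in> {t0..T}" for e t
  proof -
    have "g (x0 t, z0 t) = 0"
      using reduced_problem_constraint[OF \<open>t0 < T\<close> \<open>e_max > 0\<close> L ode cont R0R R close e(3)] by blast
    then have "norm (g (x e t, z e t)) \<le> L * norm ((x e t, z e t) - (x0 t, z0 t))"
      using L(2)[OF R[OF e] R0R[OF e(3)]] by simp
    also have "\<dots> \<le> L * (C * e)" by (intro mult_left_mono close e L)
    finally show ?thesis by simp
  qed
  then show ?thesis using R by (intro exI[of _ R] exI[of _ "L * C"]) auto
qed

section \<open>A coupled contraction principle\<close>

text \<open>The map \<open>(F1, F2)\<close> itself need not be a contraction, because \<open>L\<close> may be large. The Gauss-Seidel variant, which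
  inserts the updated first component \<open>F1 X Z\<close> into \<open>F2\<close>, has the same fixed points, and in its Lipschitz
  constant \<open>L\<close> appears only in the product \<open>l L\<close>, which is small.\<close>

lemma coupled_contraction_fixed_point:
  fixes cx :: "'a::banach" and cz :: "'b::banach"
  assumes nonneg: "\<rho> \<ge> 0" "l \<ge> 0" "L \<ge> 0"
    and F1: "\<And>X Z X' Z'. \<lbrakk>X \<in> cball cx \<rho>; Z \<in> cball cz \<rho>; X' \<in> cball cx \<rho>; Z' \<in> cball cz \<rho>\<rbrakk> \<Longrightarrow>
      norm (F1 X Z - F1 X' Z') \<le> l * (norm (X - X') + norm (Z - Z'))"
    and F2: "\<And>X Z X' Z'. \<lbrakk>X \<in> cball cx \<rho>; Z \<in> cball cz \<rho>; X' \<in> cball cx \<rho>; Z' \<in> cball cz \<rho>\<rbrakk> \<Longrightarrow>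
      norm (F2 X Z - F2 X' Z') \<le> L * norm (X - X') + norm (Z - Z') / 8"
    and l: "l * (1 + L) \<le> 1 / 8"
    and d: "norm (F1 cx cz - cx) \<le> d" "norm (F2 cx cz - cz) \<le> d" "(1 + L) * d \<le> \<rho> / 2"
  shows "\<exists>!p. p \<in> cball cx \<rho> \<times> cball cz \<rho> \<and> fst p = F1 (fst p) (snd p) \<and> snd p = F2 (fst p) (snd p)"
    and "\<And>X Z. \<lbrakk>X \<in> cball cx \<rho>; Z \<in> cball cz \<rho>; X = F1 X Z; Z = F2 X Z\<rbrakk> \<Longrightarrow>
      norm (X - cx) + norm (Z - cz) \<le> 2 * (2 + L) * d"
proof -
  let ?S = "cball cx \<rho> \<times> cball cz \<rho>"
  have c: "cx \<in> cball cx \<rho>" "cz \<in> cball cz \<rho>" using nonneg by auto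
  have d0: "d \<ge> 0" using d(1) norm_ge_zero order_trans by blast
  have "0 \<le> L * l" using nonneg by simp
  moreover have "l + L * l \<le> 1/8" using l by (simp add: algebra_simps)
  ultimately have ll: "l \<le> 1/8" "L * l \<le> 1/8" "l + L * l \<le> 1/8" using nonneg by linarith+
  have "0 \<le> L * d" using nonneg d0 by simp
  moreover have "L * d + d \<le> \<rho> / 2" using d(3) by (simp add: algebra_simps)
  ultimately have dd: "d \<le> \<rho> / 2" "L * d + d \<le> \<rho> / 2" by linarith+
  define G where "G p = (let X = F1 (fst p) (snd p) in (X, F2 X (snd p)))" for p
  have near_F1: "norm (F1 X Z - cx) \<le> l * (norm (X - cx) + norm (Z - cz)) + d"
    if "X \<in> cball cx \<rho>" "Z \<in> cball cz \<rho>" for X Z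
    using norm_triangle_ineq[of "F1 X Z - F1 cx cz" "F1 cx cz - cx"] F1[OF that c] d(1) by simp
  have near_F2: "norm (F2 X Z - cz) \<le> L * norm (X - cx) + norm (Z - cz) / 8 + d"
    if "X \<in> cball cx \<rho>" "Z \<in> cball cz \<rho>" for X Z
    using norm_triangle_ineq[of "F2 X Z - F2 cx cz" "F2 cx cz - cz"] F2[OF that c] d(2) by simp
  have F1_ball: "F1 X Z \<in> cball cx \<rho> \<and> L * norm (F1 X Z - cx) \<le> \<rho> / 4 + L * d"
    if XZ: "X \<in> cball cx \<rho>" "Z \<in> cball cz \<rho>" for X Z
  proof -
    have "norm (X - cx) + norm (Z - cz) \<le> 2 * \<rho>" using that by (auto simp: dist_norm norm_minus_commute)
    then have 1: "norm (F1 X Z - cx) \<le> l * (2 * \<rho>) + d"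
      using near_F1[OF XZ] mult_left_mono[OF _ nonneg(2)] by fastforce
    have 2: "l * (2 * \<rho>) \<le> \<rho> / 4" "L * l * (2 * \<rho>) \<le> \<rho> / 4"
      using mult_right_mono[OF ll(1), of "2 * \<rho>"] mult_right_mono[OF ll(2), of "2 * \<rho>"] nonneg by auto
    have "L * norm (F1 X Z - cx) \<le> L * (l * (2 * \<rho>) + d)" using 1 nonneg by (intro mult_left_mono)
    then show ?thesis using 1 2 dd nonneg by (auto simp: dist_norm norm_minus_commute algebra_simps)
  qed
  have G_into: "G ` ?S \<subseteq> ?S"
  proof safe
    fix p X Z X' Z'
    assume XZ: "X \<in> cball cx \<rho>" "Z \<in> cball cz \<rho>" and G: "(X', Z') = G (X, Z)"
    have X': "X' = F1 X Z" and Z': "Z' = F2 X' Z" using G by (auto simp: G_def Let_def)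
    show "X' \<in> cball cx \<rho>" using F1_ball[OF XZ] X' by simp
    then have "norm (Z' - cz) \<le> (\<rho> / 4 + L * d) + \<rho> / 8 + d"
      using near_F2[of X' Z] F1_ball[OF XZ] XZ unfolding Z' X' by (auto simp: dist_norm norm_minus_commute)
    then show "Z' \<in> cball cz \<rho>" using dd nonneg by (auto simp: dist_norm norm_minus_commute)
  qed
  have G_contr: "dist (G p) (G q) \<le> (1/2) * dist p q" if "p \<in> ?S" "q \<in> ?S" for p q
  proof -
    obtain X Z X' Z' where pq: "p = (X, Z)" "q = (X', Z')" by (cases p, cases q)
    have b: "X \<in> cball cx \<rho>" "Z \<in> cball cz \<rho>" "X' \<in> cball cx \<rho>" "Z' \<in> cball cz \<rho>" using that pq by auto
    define D where "D = norm (X - X') + norm (Z - Z')"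
    have 1: "norm (F1 X Z - F1 X' Z') \<le> l * D" unfolding D_def by (rule F1[OF b])
    have "norm (F2 (F1 X Z) Z - F2 (F1 X' Z') Z') \<le> L * norm (F1 X Z - F1 X' Z') + norm (Z - Z') / 8"
      using F1_ball b by (intro F2) auto
    also have "\<dots> \<le> L * (l * D) + D / 8" using 1 nonneg by (intro add_mono mult_left_mono) (auto simp: D_def)
    finally have 2: "norm (F2 (F1 X Z) Z - F2 (F1 X' Z') Z') \<le> L * l * D + D / 8" by simp
    have D0: "D \<ge> 0" by (simp add: D_def)
    have "dist (G p) (G q) \<le> norm (F1 X Z - F1 X' Z') + norm (F2 (F1 X Z) Z - F2 (F1 X' Z') Z')"
      by (simp add: pq G_def Let_def dist_norm norm_Pair_le)
    also have "\<dots> \<le> (l + L * l) * D + D / 8" using 1 2 by (simp add: algebra_simps)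
    also have "\<dots> \<le> D / 4" using mult_right_mono[OF ll(3) D0] by simp
    \<comment> \<open>The sum of the component norms is at most twice the Euclidean product distance, so the factor \<open>1/4\<close> in the sum becomes \<open>1/2\<close>.\<close>
    also have "D \<le> 2 * dist p q"
      using dist_fst_le[of p q] dist_snd_le[of p q] by (simp add: D_def pq dist_norm)
    then have "D / 4 \<le> (1/2) * dist p q" by simp
    finally show ?thesis .
  qed
  have "\<exists>!p\<in>?S. G p = p"
  proof (rule Banach_fix[of _ "1/2"])
    show "complete ?S" by (simp add: complete_eq_closed closed_Times)
  qed (use G_into G_contr c in auto)
  moreover have "(p \<in> ?S \<and> G p = p) \<longleftrightarrow> (p \<in> ?S \<and> fst p = F1 (fst p) (snd p) \<and> snd p = F2 (fst p) (snd p))" for p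
    by (cases p) (auto simp: G_def Let_def)
  ultimately show "\<exists>!p. p \<in> ?S \<and> fst p = F1 (fst p) (snd p) \<and> snd p = F2 (fst p) (snd p)" by simp
  show "norm (X - cx) + norm (Z - cz) \<le> 2 * (2 + L) * d"
    if XZ: "X \<in> cball cx \<rho>" "Z \<in> cball cz \<rho>" and fp: "X = F1 X Z" "Z = F2 X Z" for X Z
  proof -
    define a b where "a = norm (X - cx)" and "b = norm (Z - cz)"
    have ab: "a \<ge> 0" "b \<ge> 0" by (auto simp: a_def b_def)
    have 1: "a \<le> l * (a + b) + d" using near_F1[OF XZ] fp(1) by (simp add: a_def b_def)
    have 2: "b \<le> L * a + b / 8 + d" using near_F2[OF XZ] fp(2) by (simp add: a_def b_def)
    have 3: "L * a \<le> L * (l * (a + b) + d)" using 1 nonneg by (intro mult_left_mono)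
    have "a + b \<le> (l + L * l) * (a + b) + b / 8 + (2 + L) * d"
      using 1 2 3 by (simp add: algebra_simps)
    also have "\<dots> \<le> (a + b) / 4 + (2 + L) * d"
      using mult_right_mono[OF ll(3), of "a + b"] ab by simp
    finally have "a + b \<le> (a + b) / 4 + (2 + L) * d" .
    moreover have "(2 + L) * d \<ge> 0" using d0 nonneg by simp
    ultimately have "a + b \<le> 2 * ((2 + L) * d)" by (simp add: field_simps)
    then show ?thesis by (simp add: a_def b_def algebra_simps)
  qed
qed

section \<open>Stacked stage vectors\<close>

lemma kron_id_mult_eq: "kron_id_mult A X = A ** X"
  by (simp add: kron_id_mult_def matrix_matrix_mult_def vec_eq_iff)

lemma mult_kron_vec: "A ** kron_vec w v = kron_vec (A *v w) v"
  by (simp add: kron_vec_def matrix_matrix_mult_def matrix_vector_mult_def vec_eq_iff sum_distrib_right mult.assoc)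

lemma mult_transpose_row:
  fixes J :: "real^'m^'m" and Z :: "real^'m^'s"
  shows "(Z ** transpose J) $ i = J *v (Z $ i)"
  by (simp add: vec_eq_iff matrix_matrix_mult_def matrix_vector_mult_def transpose_def mult.commute)

lemma norm_kron_vec_one: "norm (kron_vec (1 :: real^'s) v) \<le> real CARD('s) * norm v"
proof -
  have "norm (kron_vec (1 :: real^'s) v) \<le> (\<Sum>i\<in>(UNIV::'s set). norm (kron_vec (1 :: real^'s) v $ i))"
    unfolding norm_vec_def by (rule L2_set_le_sum) auto
  then show ?thesis by (simp add: kron_vec_def)
qed

lemma matrix_mult_bounded:
  fixes A :: "real^'r^'s"
  shows "\<exists>a>0. \<forall>Y::real^'m^'r. norm (A ** Y) \<le> a * norm Y"
proof -
  have "bounded_linear (\<lambda>Y::real^'m^'r. A ** Y)"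
    by (intro linear_conv_bounded_linear[THEN iffD1] linearI)
      (auto simp: matrix_add_ldistrib matrix_scalar_ac scalar_matrix_assoc[symmetric])
  then show ?thesis using bounded_linear.pos_bounded by (metis mult.commute)
qed

lemma norm_le_blockwise:
  fixes W U V :: "real^'m^'s"
  assumes "a \<ge> 0" "b \<ge> 0" "\<And>i. norm (W $ i) \<le> a * norm (U $ i) + b * norm (V $ i)"
  shows "norm W \<le> a * norm U + b * norm V"
proof -
  have "norm W \<le> L2_set (\<lambda>i. a * norm (U $ i) + b * norm (V $ i)) UNIV"
    unfolding norm_vec_def[of W] using assms(3) by (intro L2_set_mono) auto
  also have "\<dots> \<le> L2_set (\<lambda>i. a * norm (U $ i)) UNIV + L2_set (\<lambda>i. b * norm (V $ i)) UNIV"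
    by (rule L2_set_triangle_ineq)
  also have "\<dots> = a * norm U + b * norm V"
    using assms by (simp add: L2_set_right_distrib norm_vec_def[of U] norm_vec_def[of V])
  finally show ?thesis .
qed

lemma block_in_cball:
  assumes "X \<in> cball (kron_vec 1 x) \<rho>"
  shows "X $ i \<in> cball x \<rho>"
proof -
  have "norm (X $ i - x) \<le> norm (X - kron_vec 1 x)"
    using Finite_Cartesian_Product.norm_nth_le[of "X - kron_vec 1 x" i] by (simp add: kron_vec_def)
  then show ?thesis using assms by (simp add: dist_norm norm_minus_commute)
qed

section \<open>Solving the stage equations\<close>

text \<open>The argument for one step, with all constants given. The stiff equation is brought to the form \<open>P Z = W\<close> and
  solved by \<open>Q\<close>; a factor \<open>\<eta> / (\<kappa> (1 + \<eta>)) \<le> 1 / \<kappa>\<close> is then all that remains of the stiffness, so the constants do not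
  depend on \<open>e\<close>. The choice \<open>\<kappa> / (8 a)\<close> for the small Lipschitz constant of \<open>g\<close> yields the contraction
  factor \<open>1/8\<close> in \<open>Z\<close>.\<close>

lemma stage_equations_solution_near_point:
  fixes M :: "('s::finite, 'r::finite) imex_glm" and x z :: "real^'m" and J :: "real^'m^'m"
    and \<xi> \<zeta> :: "real^'m^'r"
  assumes pos: "e > 0" "h > 0" "\<kappa> > 0" "a > 0" "L \<ge> 0" "\<rho> \<ge> 0" "u \<ge> 0"
    and low: "\<And>Y::real^'m^'s. \<kappa> * (1 + h/e) * norm Y \<le> norm (Y - (h/e) *\<^sub>R (A_imp M ** (Y ** transpose J)))"
    and pre: "preconsistent M w0"
    and a: "\<And>Y::real^'m^'s. norm (A_exp M ** Y) \<le> a * norm Y" "\<And>Y::real^'m^'s. norm (A_imp M ** Y) \<le> a * norm Y"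
    and u: "\<And>Y::real^'m^'r. norm (U_exp M ** Y) \<le> u * norm Y" "\<And>Y::real^'m^'r. norm (U_imp M ** Y) \<le> u * norm Y"
    and f: "\<And>p q. \<lbrakk>p \<in> cball x \<rho> \<times> cball z \<rho>; q \<in> cball x \<rho> \<times> cball z \<rho>\<rbrakk> \<Longrightarrow>
       norm (f p - f q) \<le> L * (norm (fst p - fst q) + norm (snd p - snd q))"
    and g: "\<And>p q. \<lbrakk>p \<in> cball x \<rho> \<times> cball z \<rho>; q \<in> cball x \<rho> \<times> cball z \<rho>\<rbrakk> \<Longrightarrow>
       norm (g p - g q - J *v (snd p - snd q)) \<le> L * norm (fst p - fst q) + \<kappa> / (8 * a) * norm (snd p - snd q)"
    and F: "norm (f (x, z)) \<le> F" and G: "norm (g (x, z)) \<le> G * e"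
    and xi: "norm (\<xi> - kron_vec w0 x) \<le> C * h" and zeta: "norm (\<zeta> - kron_vec w0 z) \<le> C * h"
    and D: "a * CARD('s) * F + u * C \<le> D" "(a * CARD('s) * G + u * C) / \<kappa> \<le> D"
    and h: "h * (a * L) * (1 + a * L / \<kappa>) \<le> 1 / 8" "(1 + a * L / \<kappa>) * (D * h) \<le> \<rho> / 2"
  defines "near \<equiv> \<lambda>X Z d. norm (X - kron_vec (1 :: real^'s) x) \<le> d \<and> norm (Z - kron_vec (1 :: real^'s) z) \<le> d"
  shows "(\<exists>!(X, Z). stage_equations M f g e h \<xi> \<zeta> X Z \<and> near X Z \<rho>) \<and>
     (\<forall>X Z. stage_equations M f g e h \<xi> \<zeta> X Z \<and> near X Z \<rho> \<longrightarrow> near X Z (2 * (2 + a * L / \<kappa>) * D * h))"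
proof -
  define \<eta> where "\<eta> = h / e"
  have eta: "\<eta> > 0" "\<eta> * e = h" using pos by (auto simp: \<eta>_def)
  define P where "P Y = Y - \<eta> *\<^sub>R (A_imp M ** (Y ** transpose J))" for Y :: "real^'m^'s"
  have "linear P"
    by (intro linearI) (auto simp: P_def matrix_add_ldistrib matrix_add_rdistrib matrix_scalar_ac
        scalar_matrix_assoc[symmetric] algebra_simps)
  moreover have "\<kappa> * (1 + \<eta>) > 0" using pos eta by simp
  moreover have "\<kappa> * (1 + \<eta>) * norm Y \<le> norm (P Y)" for Y using low by (simp add: P_def \<eta>_def)
  ultimately obtain Q where Q: "\<And>Z W. P Z = W \<longleftrightarrow> Z = Q W"
    and Q_lip: "\<And>W W'. \<kappa> * (1 + \<eta>) * norm (Q W - Q W') \<le> norm (W - W')"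
    using bounded_below_inverse[of P "\<kappa> * (1 + \<eta>)"] by metis
  let ?X0 = "kron_vec (1 :: real^'s) x" and ?Z0 = "kron_vec (1 :: real^'s) z"
  define R where "R X Z = stagewise g X Z - Z ** transpose J" for X Z :: "real^'m^'s"
  define F1 where "F1 X Z = h *\<^sub>R (A_exp M ** stagewise f X Z) + U_exp M ** \<xi>" for X Z
  define F2 where "F2 X Z = Q (\<eta> *\<^sub>R (A_imp M ** R X Z) + U_imp M ** \<zeta>)" for X Z
  have eqs: "stage_equations M f g e h \<xi> \<zeta> X Z \<longleftrightarrow> X = F1 X Z \<and> Z = F2 X Z" for X Z
  proof -
    have "Z = h *\<^sub>R (A_imp M ** ((1 / e) *\<^sub>R stagewise g X Z)) + U_imp M ** \<zeta>
      \<longleftrightarrow> P Z = \<eta> *\<^sub>R (A_imp M ** R X Z) + U_imp M ** \<zeta>"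
      by (simp add: P_def R_def matrix_diff_ldistrib matrix_scalar_ac scalar_matrix_assoc[symmetric] \<eta>_def algebra_simps)
    then show ?thesis by (simp add: stage_equations_def kron_id_mult_eq F1_def F2_def Q)
  qed
  have F1_lip: "norm (F1 X Z - F1 X' Z') \<le> h * (a * L) * (norm (X - X') + norm (Z - Z'))"
    if b: "X \<in> cball ?X0 \<rho>" "Z \<in> cball ?Z0 \<rho>" "X' \<in> cball ?X0 \<rho>" "Z' \<in> cball ?Z0 \<rho>" for X Z X' Z'
  proof -
    have "norm (stagewise f X Z - stagewise f X' Z') \<le> L * norm (X - X') + L * norm (Z - Z')"
      using f[of "(X $ i, Z $ i)" "(X' $ i, Z' $ i)" for i] b pos
      by (intro norm_le_blockwise) (auto simp: stagewise_def block_in_cball distrib_left simp del: mem_cball)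
    then have "norm (A_exp M ** (stagewise f X Z - stagewise f X' Z')) \<le> a * (L * norm (X - X') + L * norm (Z - Z'))"
      using pos by (intro order_trans[OF a(1)] mult_left_mono) auto
    then have "h * norm (A_exp M ** (stagewise f X Z - stagewise f X' Z')) \<le> h * (a * (L * norm (X - X') + L * norm (Z - Z')))"
      using pos by (intro mult_left_mono) auto
    moreover have "F1 X Z - F1 X' Z' = h *\<^sub>R (A_exp M ** (stagewise f X Z - stagewise f X' Z'))"
      by (simp add: F1_def matrix_diff_ldistrib scaleR_diff_right)
    ultimately show ?thesis using pos by (simp add: algebra_simps)
  qed
  have Q_le: "norm (Q W - Q W') \<le> c / \<kappa>" if "norm (W - W') \<le> \<eta> * c" "c \<ge> 0" for W W' c
  proof -
    have "\<kappa> * (1 + \<eta>) * norm (Q W - Q W') \<le> \<eta> * c" using Q_lip that(1) order_trans by blast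
    also have "\<dots> \<le> (1 + \<eta>) * c" using that by (intro mult_right_mono) auto
    finally have "(1 + \<eta>) * (\<kappa> * norm (Q W - Q W')) \<le> (1 + \<eta>) * c" by (simp add: mult_ac)
    then have "\<kappa> * norm (Q W - Q W') \<le> c" using eta by simp
    then show ?thesis using pos by (simp add: pos_le_divide_eq mult.commute)
  qed
  have F2_lip: "norm (F2 X Z - F2 X' Z') \<le> a * L / \<kappa> * norm (X - X') + norm (Z - Z') / 8"
    if b: "X \<in> cball ?X0 \<rho>" "Z \<in> cball ?Z0 \<rho>" "X' \<in> cball ?X0 \<rho>" "Z' \<in> cball ?Z0 \<rho>" for X Z X' Z'
  proof -
    let ?c = "a * (L * norm (X - X') + \<kappa> / (8 * a) * norm (Z - Z'))"
    have "(R X Z - R X' Z') $ i = g (X $ i, Z $ i) - g (X' $ i, Z' $ i) - J *v (Z $ i - Z' $ i)" for i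
      by (simp add: R_def stagewise_def mult_transpose_row matrix_vector_mult_diff_distrib)
    then have "norm (R X Z - R X' Z') \<le> L * norm (X - X') + \<kappa> / (8 * a) * norm (Z - Z')"
      using g[of "(X $ i, Z $ i)" "(X' $ i, Z' $ i)" for i] b pos
      by (intro norm_le_blockwise) (auto simp: block_in_cball simp del: mem_cball)
    then have "norm (A_imp M ** (R X Z - R X' Z')) \<le> ?c"
      using pos by (intro order_trans[OF a(2)] mult_left_mono) auto
    moreover have "(\<eta> *\<^sub>R (A_imp M ** R X Z) + U_imp M ** \<zeta>) - (\<eta> *\<^sub>R (A_imp M ** R X' Z') + U_imp M ** \<zeta>)
      = \<eta> *\<^sub>R (A_imp M ** (R X Z - R X' Z'))"
      by (simp add: matrix_diff_ldistrib scaleR_diff_right)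
    ultimately have "norm (F2 X Z - F2 X' Z') \<le> ?c / \<kappa>"
      unfolding F2_def using pos eta by (intro Q_le) auto
    also have "\<dots> = a * L / \<kappa> * norm (X - X') + norm (Z - Z') / 8" using pos by (simp add: field_simps)
    finally show ?thesis .
  qed
  have pre': "U_exp M ** kron_vec w0 x = ?X0" "U_imp M ** kron_vec w0 z = ?Z0"
    using pre by (auto simp: mult_kron_vec preconsistent_def)
  have "norm (F1 ?X0 ?Z0 - ?X0) \<le> D * h"
  proof -
    have "stagewise f ?X0 ?Z0 = kron_vec 1 (f (x, z))" by (simp add: stagewise_def kron_vec_def vec_eq_iff)
    then have "F1 ?X0 ?Z0 - ?X0 = h *\<^sub>R (A_exp M ** kron_vec 1 (f (x, z))) + U_exp M ** (\<xi> - kron_vec w0 x)"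
      by (simp add: F1_def matrix_diff_ldistrib pre')
    also have "norm \<dots> \<le> h * (a * (CARD('s) * F)) + u * (C * h)"
    proof (intro norm_triangle_mono)
      have "norm (A_exp M ** kron_vec 1 (f (x, z))) \<le> a * (CARD('s) * F)"
        using pos F by (intro order_trans[OF a(1)] mult_left_mono order_trans[OF norm_kron_vec_one]) auto
      then show "norm (h *\<^sub>R (A_exp M ** kron_vec 1 (f (x, z)))) \<le> h * (a * (CARD('s) * F))" using pos by simp
      show "norm (U_exp M ** (\<xi> - kron_vec w0 x)) \<le> u * (C * h)"
        using pos xi by (intro order_trans[OF u(1)] mult_left_mono) auto
    qed
    also have "\<dots> = (a * CARD('s) * F + u * C) * h" by (simp add: algebra_simps)
    also have "\<dots> \<le> D * h" using D pos by (intro mult_right_mono) auto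
    finally show ?thesis .
  qed
  moreover have "norm (F2 ?X0 ?Z0 - ?Z0) \<le> D * h"
  proof -
    have st: "stagewise g ?X0 ?Z0 = kron_vec 1 (g (x, z))" by (simp add: stagewise_def kron_vec_def vec_eq_iff)
    let ?W = "\<eta> *\<^sub>R (A_imp M ** R ?X0 ?Z0) + U_imp M ** \<zeta>"
    have "?W - P ?Z0 = \<eta> *\<^sub>R (A_imp M ** kron_vec 1 (g (x, z))) + U_imp M ** (\<zeta> - kron_vec w0 z)"
      by (simp add: P_def R_def st matrix_diff_ldistrib pre' algebra_simps)
    also have "norm \<dots> \<le> \<eta> * (a * (CARD('s) * (G * e))) + u * (C * h)"
    proof (intro norm_triangle_mono)
      have "norm (A_imp M ** kron_vec 1 (g (x, z))) \<le> a * (CARD('s) * (G * e))"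
        using pos G by (intro order_trans[OF a(2)] mult_left_mono order_trans[OF norm_kron_vec_one]) auto
      then show "norm (\<eta> *\<^sub>R (A_imp M ** kron_vec 1 (g (x, z)))) \<le> \<eta> * (a * (CARD('s) * (G * e)))" using eta by simp
      show "norm (U_imp M ** (\<zeta> - kron_vec w0 z)) \<le> u * (C * h)"
        using pos zeta by (intro order_trans[OF u(2)] mult_left_mono) auto
    qed
    also have "\<dots> = (a * CARD('s) * G + u * C) * h" by (simp add: algebra_simps flip: eta(2))
    \<comment> \<open>The defect of the stiff equation is \<open>O(h)\<close>: the factor \<open>\<eta>\<close> meets \<open>g = O(e)\<close>, and \<open>\<eta> e = h\<close>.\<close>
    finally have W: "norm (?W - P ?Z0) \<le> (a * CARD('s) * G + u * C) * h" .
    have "Q (P ?Z0) = ?Z0" using Q by metis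
    then have "\<kappa> * norm (F2 ?X0 ?Z0 - ?Z0) \<le> \<kappa> * (1 + \<eta>) * norm (F2 ?X0 ?Z0 - ?Z0)"
      using pos eta by (intro mult_right_mono) auto
    also have "\<dots> \<le> norm (?W - P ?Z0)" using Q_lip[of ?W "P ?Z0"] \<open>Q (P ?Z0) = ?Z0\<close> by (simp add: F2_def)
    also note W
    finally have "norm (F2 ?X0 ?Z0 - ?Z0) \<le> (a * CARD('s) * G + u * C) / \<kappa> * h"
      using pos by (simp add: pos_le_divide_eq mult.commute)
    also have "\<dots> \<le> D * h" using D pos by (intro mult_right_mono) auto
    finally show ?thesis .
  qed
  moreover have "0 \<le> h * (a * L)" "0 \<le> a * L / \<kappa>" using pos by auto
  ultimately have fix_ex: "\<exists>!p. p \<in> cball ?X0 \<rho> \<times> cball ?Z0 \<rho> \<and> fst p = F1 (fst p) (snd p) \<and> snd p = F2 (fst p) (snd p)"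
    and fix_near: "\<And>X Z. \<lbrakk>X \<in> cball ?X0 \<rho>; Z \<in> cball ?Z0 \<rho>; X = F1 X Z; Z = F2 X Z\<rbrakk> \<Longrightarrow>
      norm (X - ?X0) + norm (Z - ?Z0) \<le> 2 * (2 + a * L / \<kappa>) * (D * h)"
    using coupled_contraction_fixed_point[OF pos(6) _ _ F1_lip F2_lip h(1) _ _ h(2)] by blast+
  have ball: "near X Z \<rho> \<longleftrightarrow> X \<in> cball ?X0 \<rho> \<and> Z \<in> cball ?Z0 \<rho>" for X Z
    by (simp add: near_def dist_norm norm_minus_commute)
  have "(\<lambda>(X, Z). stage_equations M f g e h \<xi> \<zeta> X Z \<and> near X Z \<rho>) =
     (\<lambda>p. p \<in> cball ?X0 \<rho> \<times> cball ?Z0 \<rho> \<and> fst p = F1 (fst p) (snd p) \<and> snd p = F2 (fst p) (snd p))"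
    by (auto simp: fun_eq_iff eqs ball)
  then have "\<exists>!(X, Z). stage_equations M f g e h \<xi> \<zeta> X Z \<and> near X Z \<rho>" using fix_ex by (simp only:)
  moreover have "near X Z (2 * (2 + a * L / \<kappa>) * D * h)"
    if "stage_equations M f g e h \<xi> \<zeta> X Z \<and> near X Z \<rho>" for X Z
    using fix_near[of X Z] that norm_ge_zero[of "X - ?X0"] norm_ge_zero[of "Z - ?Z0"]
    unfolding eqs ball by (simp add: near_def mult.assoc del: mem_cball norm_ge_zero)
  ultimately show ?thesis by blast
qed

theorem theorem4:
  fixes f g :: "(real^'m) \<times> (real^'m) \<Rightarrow> real^'m"
    and x z :: "real \<Rightarrow> real \<Rightarrow> real^'m"
    and xk zk :: "nat \<Rightarrow> real \<Rightarrow> real^'m"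
    and t0 T e_max \<delta> :: real
    and M :: "('s::{finite,linorder}, 'r::finite) imex_glm"
    and w0 :: "real^'r"
  assumes "smooth_on UNIV f" and "smooth_on UNIV g"
    and "t0 < T" and "e_max > 0"
    and "\<And>e t. \<lbrakk>0 < e; e \<le> e_max; t \<in> {t0..T}\<rbrakk> \<Longrightarrow>
           (x e has_vector_derivative f (x e t, z e t)) (at t within {t0..T})"
    and "\<And>e t. \<lbrakk>0 < e; e \<le> e_max; t \<in> {t0..T}\<rbrakk> \<Longrightarrow>
           (z e has_vector_derivative (1 / e) *\<^sub>R g (x e t, z e t)) (at t within {t0..T})"
    and "smooth_eps_expansion e_max {t0..T} x xk"
    and "smooth_eps_expansion e_max {t0..T} z zk"
    and "\<delta> > 0"
    and "\<And>e t p. \<lbrakk>0 < e; e \<le> e_max; t \<in> {t0..T}; p \<in> ball (x e t, z e t) \<delta>\<rbrakk> \<Longrightarrow>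
           invertible (jacobian_snd g p) \<and> log_norm (jacobian_snd g p) \<le> -1"
    and "strictly_lower_triangular (A_exp M)"
    and "preconsistent M w0"
    and "\<And>l. complex_eigenvalue (A_imp M) l \<Longrightarrow> Re l > 0"
  shows "\<exists>\<rho>>0. \<forall>C. \<exists>h0>0. \<exists>K. \<forall>e h. \<forall>n::nat. \<forall>(\<xi>::real^'m^'r) (\<zeta>::real^'m^'r).
           0 < e \<longrightarrow> e \<le> e_max \<longrightarrow> 0 < h \<longrightarrow> h \<le> h0 \<longrightarrow> n \<ge> 1 \<longrightarrow>
           (let t = t0 + real (n - 1) * h;
                near = (\<lambda>X Z d.
                   norm (X - kron_vec 1 (x e t)) \<le> d \<and> norm (Z - kron_vec 1 (z e t)) \<le> d) in
            t \<le> T \<longrightarrow>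
            norm (\<xi> - kron_vec w0 (x e t)) \<le> C * h \<longrightarrow>
            norm (\<zeta> - kron_vec w0 (z e t)) \<le> C * h \<longrightarrow>
            (\<exists>!(X, Z). stage_equations M f g e h \<xi> \<zeta> X Z \<and> near X Z \<rho>) \<and>
            (\<forall>X Z. stage_equations M f g e h \<xi> \<zeta> X Z \<and> near X Z \<rho> \<longrightarrow> near X Z (K * h)))"
proof -
  note f = assms(1) and g = assms(2)
  obtain R G where RG: "\<And>e t. 0 < e \<Longrightarrow> e \<le> e_max \<Longrightarrow> t \<in> {t0..T} \<Longrightarrow>
     norm (x e t, z e t) \<le> R \<and> norm (g (x e t, z e t)) \<le> G * e"
    using trajectory_bounds[OF g assms(3,4,6,7,8)] by metis
  obtain B where B: "\<And>p. p \<in> cball 0 R \<Longrightarrow> norm (jacobian_snd g p) \<le> B"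
    using jacobian_snd_bounded[OF g] by metis
  obtain \<kappa> where \<kappa>: "\<kappa> > 0" and low: "\<And>(J::real^'m^'m) \<eta> (Y::real^'m^('s::{finite,linorder})). norm J \<le> B \<Longrightarrow>
     (\<And>y. (J *v y) \<bullet> y \<le> - (norm y)\<^sup>2) \<Longrightarrow> 0 \<le> \<eta> \<Longrightarrow>
     \<kappa> * (1 + \<eta>) * norm Y \<le> norm (Y - \<eta> *\<^sub>R (A_imp M ** (Y ** transpose J)))"
    using stage_operator_bounded_below[of "A_imp M" B] assms(13) by metis
  obtain a1 a2 u1 u2 where a12: "a1 > 0" "a2 > 0" "u1 > 0" "u2 > 0"
    "\<And>Y::real^'m^('s::{finite,linorder}). norm (A_exp M ** Y) \<le> a1 * norm Y" "\<And>Y::real^'m^('s::{finite,linorder}). norm (A_imp M ** Y) \<le> a2 * norm Y"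
    "\<And>Y::real^'m^'r. norm (U_exp M ** Y) \<le> u1 * norm Y" "\<And>Y::real^'m^'r. norm (U_imp M ** Y) \<le> u2 * norm Y"
    using matrix_mult_bounded by metis
  define a u where "a = max a1 a2" and "u = max u1 u2"
  have a: "a > 0" "norm (A_exp M ** Y) \<le> a * norm Y" "norm (A_imp M ** Y) \<le> a * norm Y"
    for Y :: "real^'m^('s::{finite,linorder})"
    using a12(1,2) a12(5,6)[of Y] mult_right_mono[of a1 a "norm Y"] mult_right_mono[of a2 a "norm Y"]
    by (auto simp: a_def)
  have u: "u > 0" "norm (U_exp M ** Y) \<le> u * norm Y" "norm (U_imp M ** Y) \<le> u * norm Y"
    for Y :: "real^'m^'r"
    using a12(3,4) a12(7,8)[of Y] mult_right_mono[of u1 u "norm Y"] mult_right_mono[of u2 u "norm Y"]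
    by (auto simp: u_def)
  \<comment> \<open>The radius is fixed here, before \<open>C\<close> and \<open>h0\<close>: it depends on \<open>g\<close>, the method and the bounds of the solution only.\<close>
  obtain Lg \<rho>g where Lg: "Lg \<ge> 0" "\<rho>g > 0" and lin: "\<And>x z y v y' v'. \<lbrakk>(x, z) \<in> cball 0 R;
      y \<in> cball x \<rho>g; v \<in> cball z \<rho>g; y' \<in> cball x \<rho>g; v' \<in> cball z \<rho>g\<rbrakk> \<Longrightarrow>
      norm (g (y, v) - g (y', v') - jacobian_snd g (x, z) *v (v - v')) \<le> Lg * norm (y - y') + \<kappa> / (8 * a) * norm (v - v')"
    using frozen_jacobian_increment[OF g, of "\<kappa> / (8 * a)" R] \<kappa> a(1) by (metis divide_pos_pos mult_pos_pos zero_less_numeral)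
  define \<rho> where "\<rho> = min \<rho>g 1"
  have \<rho>: "\<rho> > 0" "\<rho> \<le> \<rho>g" "\<rho> \<le> 1" using Lg by (auto simp: \<rho>_def)
  obtain Lf where Lf: "Lf \<ge> 0" "\<And>p q. p \<in> cball 0 (R + 2) \<Longrightarrow> q \<in> cball 0 (R + 2) \<Longrightarrow> norm (f p - f q) \<le> Lf * norm (p - q)"
    using C1_lipschitz_on_ball[OF f] by metis
  define L where "L = max Lf Lg"
  have L: "L \<ge> 0" "Lf \<le> L" "Lg \<le> L" using Lf by (auto simp: L_def)
  have R0: "R \<ge> 0" using RG[of e_max t0] assms(3,4) norm_ge_zero order_trans by (metis atLeastAtMost_iff less_imp_le order_refl)
  define F where "F = norm (f 0) + Lf * R"
  have F: "norm (f p) \<le> F" if "p \<in> cball 0 R" for p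
  proof -
    have "norm (f p - f 0) \<le> Lf * norm (p - 0)" using that R0 by (intro Lf) auto
    also have "\<dots> \<le> Lf * R" using that Lf by (intro mult_left_mono) auto
    finally show ?thesis using norm_triangle_sub[of "f p" "f 0"] by (simp add: F_def)
  qed
  show ?thesis
  proof (rule exI[of _ \<rho>], intro conjI \<rho>(1) allI)
    fix C
    \<comment> \<open>\<open>D h\<close> bounds the defect of both stage equations at the stacked solution value.\<close>
    define D where "D = max 1 (max (a * CARD('s) * F + u * C) ((a * CARD('s) * G + u * C) / \<kappa>))"
    have D: "D > 0" "a * CARD('s) * F + u * C \<le> D" "(a * CARD('s) * G + u * C) / \<kappa> \<le> D"
      by (auto simp: D_def)
    define q where "q = 1 + a * L / \<kappa>"
    have q: "q \<ge> 1" using a \<kappa> L by (simp add: q_def)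
    \<comment> \<open>The first bound makes the coupled map a contraction, the second keeps its image inside the ball of radius \<open>\<rho>\<close>.\<close>
    define h0 where "h0 = min (1 / (8 * (a * L + 1) * q)) (\<rho> / (2 * q * D))"
    have h0: "h0 > 0" using q \<rho> D a L by (auto simp: h0_def add_nonneg_pos intro!: divide_pos_pos mult_pos_pos)
    have h_small: "h * (a * L) * q \<le> 1 / 8" "q * (D * h) \<le> \<rho> / 2" if "0 < h" "h \<le> h0" for h
    proof -
      have aL: "a * L \<ge> 0" using a L by simp
      have "h \<le> 1 / (8 * (a * L + 1) * q)" "h \<le> \<rho> / (2 * q * D)" using that by (auto simp: h0_def)
      then have 1: "h * (8 * (a * L + 1) * q) \<le> 1" and 2: "h * (2 * q * D) \<le> \<rho>"
        using q D aL by (simp_all add: pos_le_divide_eq)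
      have "h * (a * L) * q \<le> h * (a * L + 1) * q" using that q by (intro mult_right_mono mult_left_mono) auto
      then show "h * (a * L) * q \<le> 1 / 8" using 1 by (simp add: algebra_simps)
      show "q * (D * h) \<le> \<rho> / 2" using 2 by (simp add: algebra_simps)
    qed
    show "\<exists>h0>0. \<exists>K. \<forall>e h. \<forall>n::nat. \<forall>(\<xi>::real^'m^'r) (\<zeta>::real^'m^'r).
           0 < e \<longrightarrow> e \<le> e_max \<longrightarrow> 0 < h \<longrightarrow> h \<le> h0 \<longrightarrow> n \<ge> 1 \<longrightarrow>
           (let t = t0 + real (n - 1) * h;
                near = (\<lambda>X Z d.
                   norm (X - kron_vec 1 (x e t)) \<le> d \<and> norm (Z - kron_vec 1 (z e t)) \<le> d) in
            t \<le> T \<longrightarrow>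
            norm (\<xi> - kron_vec w0 (x e t)) \<le> C * h \<longrightarrow>
            norm (\<zeta> - kron_vec w0 (z e t)) \<le> C * h \<longrightarrow>
            (\<exists>!(X, Z). stage_equations M f g e h \<xi> \<zeta> X Z \<and> near X Z \<rho>) \<and>
            (\<forall>X Z. stage_equations M f g e h \<xi> \<zeta> X Z \<and> near X Z \<rho> \<longrightarrow> near X Z (K * h)))"
      unfolding Let_def
    proof (rule exI[of _ h0], intro conjI h0 exI[of _ "2 * (2 + a * L / \<kappa>) * D"], intro allI impI)
      fix e h and n :: nat and \<xi> \<zeta> :: "real^'m^'r"
      let ?t = "t0 + real (n - 1) * h"
      assume e: "0 < e" "e \<le> e_max" and h: "0 < h" "h \<le> h0" and "n \<ge> 1" "?t \<le> T"
        and xi: "norm (\<xi> - kron_vec w0 (x e ?t)) \<le> C * h"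
        and zeta: "norm (\<zeta> - kron_vec w0 (z e ?t)) \<le> C * h"
      have t: "?t \<in> {t0..T}" using h \<open>?t \<le> T\<close> by simp
      let ?c = "(x e ?t, z e ?t)"
      let ?J = "jacobian_snd g ?c"
      have c: "?c \<in> cball 0 R" using RG[OF e t] by simp
      have "log_norm ?J \<le> -1" using assms(10)[OF e t, of ?c] assms(9) by simp
      then have diss: "(?J *v y) \<bullet> y \<le> - (norm y)\<^sup>2" for y
        using log_norm_inner_le[of ?J y] mult_right_mono[of "log_norm ?J" "-1" "(norm y)\<^sup>2"] by simp
      have tube: "p \<in> cball 0 (R + 2)" if "p \<in> cball (x e ?t) \<rho> \<times> cball (z e ?t) \<rho>" for p
      proof -
        have "norm (p - ?c) \<le> norm (fst p - x e ?t) + norm (snd p - z e ?t)"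
          by (cases p) (simp add: norm_Pair_le)
        also have "\<dots> \<le> 2" using that \<rho>(3) by (cases p) (simp add: dist_norm norm_minus_commute)
        finally show ?thesis using norm_triangle_sub[of p ?c] c by simp
      qed
      show "(\<exists>!(X, Z). stage_equations M f g e h \<xi> \<zeta> X Z \<and>
               norm (X - kron_vec 1 (x e ?t)) \<le> \<rho> \<and> norm (Z - kron_vec 1 (z e ?t)) \<le> \<rho>) \<and>
            (\<forall>X Z. stage_equations M f g e h \<xi> \<zeta> X Z \<and>
               norm (X - kron_vec 1 (x e ?t)) \<le> \<rho> \<and> norm (Z - kron_vec 1 (z e ?t)) \<le> \<rho> \<longrightarrow>
               norm (X - kron_vec 1 (x e ?t)) \<le> 2 * (2 + a * L / \<kappa>) * D * h \<and>
               norm (Z - kron_vec 1 (z e ?t)) \<le> 2 * (2 + a * L / \<kappa>) * D * h)"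
      proof (rule stage_equations_solution_near_point[where J = ?J and ?w0.0 = w0 and u = u and F = F and G = G and C = C])
        show "\<kappa> * (1 + h / e) * norm Y \<le> norm (Y - (h / e) *\<^sub>R (A_imp M ** (Y ** transpose ?J)))" for Y :: "real^'m^('s::{finite,linorder})"
          using e h by (intro low B c diss) auto
        show "norm (g ?c) \<le> G * e" using RG[OF e t] by simp
        show "norm (f p - f q) \<le> L * (norm (fst p - fst q) + norm (snd p - snd q))"
          if "p \<in> cball (x e ?t) \<rho> \<times> cball (z e ?t) \<rho>" "q \<in> cball (x e ?t) \<rho> \<times> cball (z e ?t) \<rho>" for p q
        proof -
          have "norm (f p - f q) \<le> Lf * norm (p - q)" using that by (intro Lf tube)
          also have "\<dots> \<le> L * (norm (fst p - fst q) + norm (snd p - snd q))"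
            using L Lf norm_Pair_le[of "fst p - fst q" "snd p - snd q"]
            by (intro mult_mono) (simp_all flip: minus_prod_def)
          finally show ?thesis .
        qed
        show "norm (g p - g q - ?J *v (snd p - snd q)) \<le> L * norm (fst p - fst q) + \<kappa> / (8 * a) * norm (snd p - snd q)"
          if "p \<in> cball (x e ?t) \<rho> \<times> cball (z e ?t) \<rho>" "q \<in> cball (x e ?t) \<rho> \<times> cball (z e ?t) \<rho>" for p q
        proof -
          have "norm (g p - g q - ?J *v (snd p - snd q)) \<le> Lg * norm (fst p - fst q) + \<kappa> / (8 * a) * norm (snd p - snd q)"
            using lin[OF c, of "fst p" "snd p" "fst q" "snd q"] that \<rho>(2) by (cases p, cases q) auto
          also have "\<dots> \<le> L * norm (fst p - fst q) + \<kappa> / (8 * a) * norm (snd p - snd q)"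
            using L by (intro add_right_mono mult_right_mono) auto
          finally show ?thesis .
        qed
      qed (rule e(1) h(1) \<kappa> a L(1) \<rho>(1)[THEN less_imp_le] u u(1)[THEN less_imp_le] assms(12)
          F[OF c] xi zeta D(2,3) h_small[OF h, unfolded q_def])+
    qed
  qed
qed

end
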